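(* Assume (UE) and (ME). Let $u_n,u\in\mathcal U$ satisfy $u_n(x)\to u(x)$ as $n\to\infty$ for each $x\in E$, and assume that for each $x\in E$ $$\sup_{B\in\mathcal E}|P^{u_n(x)}(x,B)-P^{u(x)}(x,B)|\to 0\quad\text{as } n\to\infty .$$ Let $c:E\times U\to\mathbb R$ be bounded, measurable, and continuous with respect to the second variable, and let $(\alpha_n)$ be a sequence of nonzero real numbers with $\alpha_n\to0$. Then for every $x\in E$ $$\frac1{\alpha_n}I_x^{\alpha_n}(u_n)\to J_x(u)\quad\text{as } n\to\infty .$$
   Context: $E$ is a Polish space with Borel $\sigma$-field $\mathcal E$; $U$ is a compact set of control parameters; $\mathcal U$ is a family of Borel measurable mappings $u:E\to U$ (Markov controls). For $a\in U$, $P^a(x,\cdot)$ denotes the transition kernel on $E$ under constant control $a$. For each $u\in\mathcal U$, $(X_t^u)_{t=0,1,2,\dots}$ is the discrete-time Markov process on $E$ with transition kernel $P^{u(x)}(x,dy)$ (assumed to be a Markov kernel), $(P^u)^n$ is the $n$-th iterate of this kernel, and $E_x^u$ is expectation when the process starts at $x$. (UE): $\ \sup_{x,x'\in E}\sup_{a,a'\in U}\sup_{B\in\mathcal E}\big(P^a(x,B)-P^{a'}(x',B)\big)=:\Delta<1$. (ME): there is an integer $m\ge1$ such that $\sup_{x,x'\in E}\sup_{u\in\mathcal U}\sup_{B\in\mathcal E}\frac{(P^u)^m(x,B)}{(P^u)^m(x',B)}=:K<\infty$; that is, $(P^u)^m(x,B)\le K\,(P^u)^m(x',B)$ for all $x,x'\in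 E$, $u\in\mathcal U$, $B\in\mathcal E$. The functionals are $$I_x^\alpha(u)=\liminf_{n\to\infty}\frac1n\ln E_x^u\Big\{e^{\alpha\sum_{i=0}^{n-1}c(X_i^u,u(X_i^u))}\Big\},\qquad J_x(u)=\liminf_{n\to\infty}\frac1n E_x^u\Big\{\sum_{i=0}^{n-1}c(X_i^u,u(X_i^u))\Big\}.$$ *)

theory Defs
  imports "HOL-Probability.Probability"
begin

section \<open>Markov kernels and Markov chains\<close>

abbreviation markov_kernel :: "('e :: topological_space \<Rightarrow> 'e measure) \<Rightarrow> bool" where
  "markov_kernel K \<equiv> K \<in> borel \<rightarrow>\<^sub>M prob_algebra borel"

primrec kernel_pow :: "('e :: topological_space \<Rightarrow> 'e measure) \<Rightarrow> nat \<Rightarrow> 'e \<Rightarrow> 'e measure" where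
  "kernel_pow K 0 x = return borel x"
| "kernel_pow K (Suc n) x = K x \<bind> kernel_pow K n"

text \<open>The conditional law of the state at time \<open>n\<close> given the states before time \<open>n\<close>, for the
  chain with transition kernel \<open>K\<close> started at \<open>x\<close>.\<close>

primrec chain_step ::
  "('e :: topological_space \<Rightarrow> 'e measure) \<Rightarrow> 'e \<Rightarrow> nat \<Rightarrow> (nat \<Rightarrow> 'e) \<Rightarrow> 'e measure" where
  "chain_step K x 0 \<omega> = return borel x"
| "chain_step K x (Suc n) \<omega> = K (\<omega> n)"

text \<open>The law on path space of that chain: the Ionescu-Tulcea measure of the above
  conditional laws.  Under it, the coordinate maps \<open>\<lambda>\<omega>. \<omega> t\<close> are the Markov chain
  started at \<open>x\<close>.\<close>

definition path_measure ::
  "('e :: topological_space \<Rightarrow> 'e measure) \<Rightarrow> 'e \<Rightarrow> (nat \<Rightarrow> 'e) measure" where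
  "path_measure K x =
     projective_family.lim UNIV (Ionescu_Tulcea.CI (chain_step K x) (\<lambda>_. borel)) (\<lambda>_. borel)"

text \<open>The assumptions of the Ionescu-Tulcea construction are met, so the definition is meaningful.\<close>

lemma Ionescu_Tulcea_chain_step:
  assumes K: "markov_kernel K"
  shows "Ionescu_Tulcea (chain_step K x) (\<lambda>_. borel)"
proof (rule Ionescu_Tulcea.intro)
  fix i
  have init: "return borel x \<in> space (subprob_algebra borel)"
    using measurable_space[OF return_measurable, of x borel] by simp
  have step: "(\<lambda>\<omega>. K (\<omega> n)) \<in> PiM {0..<Suc n} (\<lambda>_. borel) \<rightarrow>\<^sub>M subprob_algebra borel" for n
    by (rule measurable_compose[OF _ measurable_prob_algebraD[OF K]])
      (rule measurable_component_singleton, simp)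
  show "chain_step K x i \<in> PiM {0..<i} (\<lambda>_. borel) \<rightarrow>\<^sub>M subprob_algebra borel"
  proof (cases i)
    case 0
    then have "chain_step K x i = (\<lambda>_. return borel x)" by auto
    then show ?thesis using init by simp
  next
    case (Suc n)
    then have "chain_step K x i = (\<lambda>\<omega>. K (\<omega> n))" by auto
    then show ?thesis using step[of n] Suc by metis
  qed
next
  fix i \<omega>
  show "prob_space (chain_step K x i \<omega>)"
    using measurable_space[OF K, of "\<omega> (i - 1)"]
    by (cases i) (auto simp: space_prob_algebra prob_space_return)
qed

lemma
  assumes K: "markov_kernel K"
  shows prob_space_path_measure: "prob_space (path_measure K x)"
    and sets_path_measure: "sets (path_measure K x) = sets (PiM UNIV (\<lambda>_. borel))"
    and distr_path_measure: "finite J \<Longrightarrow>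
      distr (path_measure K x) (PiM J (\<lambda>_. borel)) (\<lambda>\<omega>. restrict \<omega> J) =
      Ionescu_Tulcea.CI (chain_step K x) (\<lambda>_. borel) J"
proof -
  interpret Ionescu_Tulcea "chain_step K x" "\<lambda>_. borel"
    by (rule Ionescu_Tulcea_chain_step[OF K])
  show sets: "sets (path_measure K x) = sets (PiM UNIV (\<lambda>_. borel))"
    by (simp add: path_measure_def)
  show d: "distr (path_measure K x) (PiM J (\<lambda>_. borel)) (\<lambda>\<omega>. restrict \<omega> J) = CI J"
    if "finite J" for J
    using that by (simp add: path_measure_def distr_lim)
  have "(\<lambda>\<omega>. restrict \<omega> {}) \<in> path_measure K x \<rightarrow>\<^sub>M PiM {} (\<lambda>_. borel)"
    by (simp add: measurable_cong_sets[OF sets refl] measurable_restrict_subset)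
  then show "prob_space (path_measure K x)"
    by (rule prob_space_distrD) (simp only: d finite.emptyI PF.prob_space_P subset_UNIV)
qed

section \<open>Controlled Markov chains\<close>

locale controlled_markov =
  fixes U :: "'u :: topological_space set"
    and \<U> :: "('e :: polish_space \<Rightarrow> 'u) set"
    and P :: "'u \<Rightarrow> 'e \<Rightarrow> 'e measure"
  assumes compact_controls: "compact U"
    and measurable_control: "u \<in> \<U> \<Longrightarrow> u \<in> borel \<rightarrow>\<^sub>M restrict_space borel U"
    and kernel_const: "a \<in> U \<Longrightarrow> markov_kernel (P a)"
    and kernel_control: "u \<in> \<U> \<Longrightarrow> markov_kernel (\<lambda>x. P (u x) x)"

definition controlled_kernel ::
  "('u \<Rightarrow> 'e \<Rightarrow> 'e measure) \<Rightarrow> ('e \<Rightarrow> 'u) \<Rightarrow> 'e \<Rightarrow> 'e measure" where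
  "controlled_kernel P u x = P (u x) x"

definition UE :: "'u set \<Rightarrow> ('u \<Rightarrow> 'e :: topological_space \<Rightarrow> 'e measure) \<Rightarrow> bool" where
  "UE U P \<longleftrightarrow>
     (SUP x. SUP x'. SUP a\<in>U. SUP a'\<in>U. SUP B\<in>sets borel.
        ereal (measure (P a x) B - measure (P a' x') B)) < 1"

text \<open>The supremum of ratios is rendered by the inequality it abbreviates, so that no
  convention for \<open>0 / 0\<close> is needed.\<close>

definition ME ::
  "('e \<Rightarrow> 'u) set \<Rightarrow> ('u \<Rightarrow> 'e :: topological_space \<Rightarrow> 'e measure) \<Rightarrow> bool" where
  "ME \<U> P \<longleftrightarrow>
     (\<exists>m\<ge>1. \<exists>K::real. \<forall>x x'. \<forall>u\<in>\<U>. \<forall>B\<in>sets borel.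
        measure (kernel_pow (controlled_kernel P u) m x) B
          \<le> K * measure (kernel_pow (controlled_kernel P u) m x') B)"

section \<open>Cost functionals\<close>

definition risk_cost ::
  "('u \<Rightarrow> 'e :: topological_space \<Rightarrow> 'e measure) \<Rightarrow> ('e \<times> 'u \<Rightarrow> real) \<Rightarrow> real \<Rightarrow> 'e \<Rightarrow>
   ('e \<Rightarrow> 'u) \<Rightarrow> ereal" where
  "risk_cost P c \<alpha> x u =
     liminf (\<lambda>n. ereal (1 / real n *
       ln (\<integral>\<omega>. exp (\<alpha> * (\<Sum>i<n. c (\<omega> i, u (\<omega> i)))) \<partial>path_measure (controlled_kernel P u) x)))"

definition average_cost ::
  "('u \<Rightarrow> 'e :: topological_space \<Rightarrow> 'e measure) \<Rightarrow> ('e \<times> 'u \<Rightarrow> real) \<Rightarrow> 'e \<Rightarrow>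
   ('e \<Rightarrow> 'u) \<Rightarrow> ereal" where
  "average_cost P c x u =
     liminf (\<lambda>n. ereal (1 / real n *
       (\<integral>\<omega>. (\<Sum>i<n. c (\<omega> i, u (\<omega> i))) \<partial>path_measure (controlled_kernel P u) x)))"

end

theory Submission
  imports Defs
begin

text \<open>Write \<open>Q\<close> for the kernel of a control \<open>v\<close> and \<open>f y = c (y, v y)\<close>.  By (UE) \<open>Q\<close> contracts
  oscillations by the factor \<open>\<Delta>\<close>, so \<open>Q\<^sup>k f\<close> tends to a constant \<open>\<rho>\<close>, and
  \<open>w = (\<Sum>k. Q\<^sup>k f - \<rho>)\<close> solves the Poisson equation \<open>w - Q w = f - \<rho>\<close> with a bound \<open>W\<close> on \<open>\<bar>w\<bar>\<close> that
  is uniform in the control.  Hence the average cost is \<open>\<rho>\<close>.  By Jensen's inequality and Hoeffding's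
  lemma the expectation of \<open>exp (\<alpha> * (\<Sum>i<n. f (X i) - \<rho>) + \<alpha> * w (X n))\<close> is nondecreasing in \<open>n\<close>
  and grows by at most the factor \<open>exp (\<alpha>\<^sup>2 * W\<^sup>2 / 2)\<close> per step, so the risk-sensitive cost
  divided by \<open>\<alpha>\<close> is within \<open>\<bar>\<alpha>\<bar> * W\<^sup>2 / 2\<close> of \<open>\<rho>\<close>, uniformly in the control.

  It remains to pass to the limit in \<open>\<rho>\<close>.  Integrating the Poisson equation of the limit control against
  the stationary law of \<open>u\<^sub>n\<close> expresses the difference of the two constants as a stationary
  mean of functions that tend to \<open>0\<close> pointwise.  (ME) bounds the stationary law by a multiple of the
  \<open>m\<close>-step law from one fixed point, under which dominated convergence applies.\<close>

section \<open>Integrals of bounded functions\<close>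

text \<open>\<open>bind\<close> is \<open>join\<close> after the image of \<open>M\<close> under
  \<open>K\<close>. Boundedness of \<open>f\<close> and total mass at most 1 of every
  \<open>K x\<close> are what make the integral against \<open>join\<close> an iterated one.\<close>

lemma integral_bind_bounded:
  fixes f :: "_ \<Rightarrow> real"
  assumes f: "f \<in> borel_measurable N" "\<And>x. x \<in> space N \<Longrightarrow> \<bar>f x\<bar> \<le> B"
    and K: "K \<in> M \<rightarrow>\<^sub>M subprob_algebra N" and M: "prob_space M"
  shows "(\<integral>x. f x \<partial>(M \<bind> K)) = (\<integral>x. \<integral>y. f y \<partial>K x \<partial>M)"
proof -
  interpret prob_space M by fact
  have "AE M' in distr M (subprob_algebra N) K. emeasure M' (space M') \<le> ennreal 1"
    by (rule AE_I2) (simp add: space_subprob_algebra subprob_space.subprob_emeasure_le_1)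
  note * = f sets_distr finite_measure_distr[OF K] this
  show ?thesis
    by (simp add: bind_nonempty''[OF K not_empty] integral_join[OF *]
        integral_distr[OF K integral_measurable_subprob_algebra[OF f(1)]])
qed

text \<open>Counting form of the layer-cake formula: the integers from 1 to \<open>N\<close> that
  lie below \<open>t\<close> are exactly those up to its integer part.\<close>

lemma sum_of_bool_le_eq_floor:
  fixes t :: real
  assumes "0 \<le> t" "t \<le> real N"
  shows "(\<Sum>j\<in>{1..N}. of_bool (real j \<le> t)) = real_of_int \<lfloor>t\<rfloor>"
proof -
  have "{j \<in> {1..N}. real j \<le> t} = {1..nat \<lfloor>t\<rfloor>}"
    using assms by (auto simp: le_nat_iff le_floor_iff)
  then show ?thesis
    using assms by (simp add: of_bool_def sum.If_cases Int_def)
qed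

text \<open>Discretized layer-cake argument. The integer part of \<open>N * g\<close> is the sum of
  the indicators of the \<open>N\<close> level sets \<open>L j\<close>, each of which contributes at
  most \<open>\<delta>\<close>. Rounding costs at most 1 in total, hence \<open>1 / N\<close> after
  division, and \<open>N\<close> tends to infinity.\<close>

lemma integral_diff_le_unit:
  fixes g :: "'a \<Rightarrow> real"
  assumes "prob_space \<mu>" "prob_space \<nu>" and sets: "sets \<mu> = sets M" "sets \<nu> = sets M"
    and \<delta>: "\<And>B. B \<in> sets M \<Longrightarrow> measure \<mu> B - measure \<nu> B \<le> \<delta>"
    and g[measurable]: "g \<in> borel_measurable M" and g01: "\<And>x. 0 \<le> g x \<and> g x \<le> 1"
  shows "(\<integral>x. g x \<partial>\<mu>) - (\<integral>x. g x \<partial>\<nu>) \<le> \<delta>"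
proof -
  interpret \<mu>: prob_space \<mu> by fact
  interpret \<nu>: prob_space \<nu> by fact
  note [measurable_cong] = sets
  have sp: "space \<mu> = space M" "space \<nu> = space M"
    using sets by (auto dest: sets_eq_imp_space_eq)
  have int: "integrable \<mu> g" "integrable \<nu> g"
    using g01 by (auto intro!: \<mu>.integrable_const_bound[of _ 1] \<nu>.integrable_const_bound[of _ 1])
  have *: "(\<integral>x. g x \<partial>\<mu>) - (\<integral>x. g x \<partial>\<nu>) \<le> \<delta> + 1 / real N" if N: "N > 0" for N
  proof -
    define L where "L j = {x \<in> space M. real j \<le> real N * g x}" for j
    have L[measurable]: "L j \<in> sets M" for j unfolding L_def by measurable
    define s where "s x = (\<Sum>j\<in>{1..N}. indicat_real (L j) x)" for x
    have s: "real N * g x - 1 \<le> s x \<and> s x \<le> real N * g x" if "x \<in> space M" for x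
    proof -
      have "s x = (\<Sum>j\<in>{1..N}. of_bool (real j \<le> real N * g x))"
        unfolding s_def L_def using that by (intro sum.cong) (auto split: split_indicator)
      also have "\<dots> = real_of_int \<lfloor>real N * g x\<rfloor>"
        using g01[of x] by (intro sum_of_bool_le_eq_floor) (auto simp: mult_left_le)
      finally show ?thesis by linarith
    qed
    have i: "integrable \<mu> (indicat_real (L j))" "integrable \<nu> (indicat_real (L j))" for j
      by (auto simp: integrable_indicator_iff \<mu>.emeasure_eq_measure \<nu>.emeasure_eq_measure)
    have int_s: "integrable \<mu> s" "integrable \<nu> s"
      unfolding s_def using i by auto
    have "(\<integral>x. s x \<partial>\<mu>) - (\<integral>x. s x \<partial>\<nu>) = (\<Sum>j\<in>{1..N}. measure \<mu> (L j) - measure \<nu> (L j))"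
      unfolding s_def using i by (simp add: sum_subtractf sp)
    also have "\<dots> \<le> (\<Sum>j\<in>{1..N}. \<delta>)"
      by (intro sum_mono \<delta> L)
    finally have 1: "(\<integral>x. s x \<partial>\<mu>) - (\<integral>x. s x \<partial>\<nu>) \<le> real N * \<delta>" by simp
    have "(\<integral>x. real N * g x - 1 \<partial>\<mu>) \<le> (\<integral>x. s x \<partial>\<mu>)"
      using s int int_s by (intro integral_mono) (auto simp: sp)
    then have 2: "real N * (\<integral>x. g x \<partial>\<mu>) - 1 \<le> (\<integral>x. s x \<partial>\<mu>)"
      using int by (simp add: \<mu>.prob_space)
    have "(\<integral>x. s x \<partial>\<nu>) \<le> (\<integral>x. real N * g x \<partial>\<nu>)"
      using s int int_s by (intro integral_mono) (auto simp: sp)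
    then have 3: "(\<integral>x. s x \<partial>\<nu>) \<le> real N * (\<integral>x. g x \<partial>\<nu>)" by simp
    from 1 2 3 have "real N * ((\<integral>x. g x \<partial>\<mu>) - (\<integral>x. g x \<partial>\<nu>)) \<le> real N * (\<delta> + 1 / real N)"
      using N by (simp add: algebra_simps)
    then show ?thesis
      using N by (simp add: mult_le_cancel_left_pos del: distrib_left_numeral)
  qed
  have "(\<lambda>N. \<delta> + 1 / real N) \<longlonglongrightarrow> \<delta> + 0"
    by (intro tendsto_intros lim_1_over_n)
  then show ?thesis
    using * by (intro LIMSEQ_le_const[of "\<lambda>N. \<delta> + 1 / real N"]) (auto intro!: exI[of _ 1])
qed

text \<open>Affine rescaling of \<open>[a, b]\<close> to the unit interval; the degenerate interval
  is treated apart because the rescaling divides by \<open>b - a\<close>.\<close>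

lemma integral_diff_le:
  fixes g :: "'a \<Rightarrow> real"
  assumes p: "prob_space \<mu>" "prob_space \<nu>" and sets: "sets \<mu> = sets M" "sets \<nu> = sets M"
    and \<delta>: "\<And>B. B \<in> sets M \<Longrightarrow> measure \<mu> B - measure \<nu> B \<le> \<delta>"
    and g[measurable]: "g \<in> borel_measurable M" and gab: "\<And>x. a \<le> g x \<and> g x \<le> b"
  shows "(\<integral>x. g x \<partial>\<mu>) - (\<integral>x. g x \<partial>\<nu>) \<le> \<delta> * (b - a)"
proof -
  interpret \<mu>: prob_space \<mu> by fact
  interpret \<nu>: prob_space \<nu> by fact
  note [measurable_cong] = sets
  have int: "integrable \<mu> g" "integrable \<nu> g"
    using gab by (auto intro!: \<mu>.integrable_const_bound[of _ "max \<bar>a\<bar> \<bar>b\<bar>"]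
        \<nu>.integrable_const_bound[of _ "max \<bar>a\<bar> \<bar>b\<bar>"] AE_I2 simp: abs_le_iff) (smt (verit))+
  show ?thesis
  proof (cases "a < b")
    case True
    have "(\<integral>x. (g x - a) / (b - a) \<partial>\<mu>) - (\<integral>x. (g x - a) / (b - a) \<partial>\<nu>) \<le> \<delta>"
      using True gab by (intro integral_diff_le_unit[OF p sets \<delta>]) auto
    then have "((\<integral>x. g x \<partial>\<mu>) - (\<integral>x. g x \<partial>\<nu>)) / (b - a) \<le> \<delta>"
      using int by (simp add: \<mu>.prob_space \<nu>.prob_space diff_divide_distrib)
    then show ?thesis using True by (simp add: divide_le_eq)
  next
    case False
    then have "a = b" using gab[of undefined] by linarith
    moreover from this have "g = (\<lambda>_. b)" using gab by (auto simp: fun_eq_iff intro: antisym)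
    ultimately
    show ?thesis by (simp add: \<mu>.prob_space \<nu>.prob_space)
  qed
qed

text \<open>Setwise domination is the order on measures, under which integrals of nonnegative
  functions are monotone. The detour through nonnegative integrals is undone at the end by
  boundedness.\<close>

lemma integral_le_mult:
  fixes h :: "'a \<Rightarrow> real"
  assumes p: "prob_space \<mu>" "prob_space \<nu>" and sets: "sets \<mu> = sets M" "sets \<nu> = sets M"
    and K: "\<And>B. B \<in> sets M \<Longrightarrow> measure \<mu> B \<le> K * measure \<nu> B"
    and h[measurable]: "h \<in> borel_measurable M" and h0: "\<And>x. 0 \<le> h x" and hb: "\<And>x. h x \<le> b"
  shows "(\<integral>x. h x \<partial>\<mu>) \<le> K * (\<integral>x. h x \<partial>\<nu>)"
proof -
  interpret \<mu>: prob_space \<mu> by fact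
  interpret \<nu>: prob_space \<nu> by fact
  note [measurable_cong] = sets
  have sp: "space \<mu> = space M" "space \<nu> = space M"
    using sets by (auto dest: sets_eq_imp_space_eq)
  \<comment> \<open>Both measures have total mass 1, so the domination on the whole space already
    forces \<open>K\<close> to be at least 1.\<close>
  have K0: "0 \<le> K"
    using K[of "space M"] \<mu>.prob_space \<nu>.prob_space sp by auto
  have int: "integrable \<mu> h" "integrable \<nu> h"
    using h0 hb by (auto intro!: \<mu>.integrable_const_bound[of _ b] \<nu>.integrable_const_bound[of _ b])
  have le: "\<mu> \<le> scale_measure (ennreal K) \<nu>"
  proof (subst le_measure)
    show "sets \<mu> = sets (scale_measure (ennreal K) \<nu>)" by (simp add: sets)
    show "\<forall>B\<in>sets \<mu>. emeasure \<mu> B \<le> emeasure (scale_measure (ennreal K) \<nu>) B"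
      using K K0 by (simp add: \<mu>.emeasure_eq_measure \<nu>.emeasure_eq_measure sets flip: ennreal_mult)
  qed
  have "ennreal (\<integral>x. h x \<partial>\<mu>) = (\<integral>\<^sup>+x. h x \<partial>\<mu>)"
    using int h0 by (intro nn_integral_eq_integral[symmetric]) auto
  also have "\<dots> \<le> (\<integral>\<^sup>+x. h x \<partial>scale_measure (ennreal K) \<nu>)"
    by (rule nn_integral_mono_measure[OF _ le]) (simp add: sets)
  also have "\<dots> = ennreal K * (\<integral>\<^sup>+x. h x \<partial>\<nu>)"
    by (rule nn_integral_scale_measure) measurable
  also have "\<dots> = ennreal (K * (\<integral>x. h x \<partial>\<nu>))"
    using int h0 K0 by (simp add: nn_integral_eq_integral ennreal_mult integral_nonneg)
  finally show ?thesis
    using h0 K0 by (subst (asm) ennreal_le_iff) (auto intro!: mult_nonneg_nonneg integral_nonneg)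
qed

section \<open>The one-step Markov property on path space\<close>

text \<open>In general \<open>CI J\<close> is a projection of \<open>C 0 (up_to J)\<close>. For an
  initial segment \<open>up_to\<close> is its length, so the projection changes nothing.\<close>

lemma (in Ionescu_Tulcea) CI_atLeast0LessThan: "CI {0..<k} = C 0 k (\<lambda>_. undefined)"
proof -
  have "\<not> up_to {0..<k} < k"
    using up_to_less[of "{0..<k}" "up_to {0..<k}"] by auto
  then have "up_to {0..<k} = k"
    by (intro antisym) (auto simp: up_to_iff_Ico)
  then show ?thesis using distr_C[of k k "\<lambda>_. undefined" 0] by (simp add: CI_def)
qed

text \<open>The Markov property tested against a functional \<open>G\<close> of the states up to
  time \<open>n\<close> and a function \<open>h\<close> of the next state. Both sides live on
  finitely many coordinates, and there the law arises by binding with \<open>eP (Suc n)\<close>,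
  which appends a coordinate drawn from \<open>K (\<omega> n)\<close>.\<close>

lemma integral_path_Suc:
  fixes G :: "(nat \<Rightarrow> 'e :: topological_space) \<Rightarrow> real" and h :: "'e \<Rightarrow> real"
  assumes K: "markov_kernel K"
    and G: "G \<in> borel_measurable (PiM {0..<Suc n} (\<lambda>_. borel))" "\<And>\<omega>. \<bar>G \<omega>\<bar> \<le> a"
    and h: "h \<in> borel_measurable borel" "\<And>x. \<bar>h x\<bar> \<le> b"
  shows "(\<integral>\<omega>. G (restrict \<omega> {0..<Suc n}) * h (\<omega> (Suc n)) \<partial>path_measure K x) =
    (\<integral>\<omega>. G (restrict \<omega> {0..<Suc n}) * (\<integral>y. h y \<partial>K (\<omega> n)) \<partial>path_measure K x)"
proof -
  interpret Ionescu_Tulcea "chain_step K x" "\<lambda>_. borel"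
    by (rule Ionescu_Tulcea_chain_step[OF K])
  let ?u = "\<lambda>_::nat. undefined :: 'e"
  note [measurable] = G(1) h(1) measurable_prob_algebraD[OF K]
  note [measurable_cong] = sets_path_measure[OF K]
  \<comment> \<open>Functionals of the first \<open>k\<close> coordinates are integrated under the
    finite-dimensional law \<open>C 0 k\<close>, which has a recursive description.\<close>
  have path: "(\<integral>\<omega>. F (restrict \<omega> {0..<k}) \<partial>path_measure K x) = (\<integral>\<omega>. F \<omega> \<partial>C 0 k ?u)"
    if "F \<in> borel_measurable (PiM {0..<k} (\<lambda>_. borel))" for F :: "(nat \<Rightarrow> 'e) \<Rightarrow> real" and k
  proof -
    have "(\<lambda>\<omega>. restrict \<omega> {0..<k}) \<in> path_measure K x \<rightarrow>\<^sub>M PiM {0..<k} (\<lambda>_. borel)"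
      by (simp add: measurable_cong_sets[OF sets_path_measure[OF K] refl] measurable_restrict_subset)
    from integral_distr[OF this that] show ?thesis
      by (simp add: distr_path_measure[OF K] CI_atLeast0LessThan)
  qed
  let ?F = "\<lambda>\<xi>. G (restrict \<xi> {0..<Suc n}) * h (\<xi> (Suc n))"
  let ?H = "\<lambda>\<xi>. G \<xi> * (\<integral>y. h y \<partial>K (\<xi> n))"
  have H[measurable]: "?H \<in> borel_measurable (PiM {0..<Suc n} (\<lambda>_. borel))"
    by measurable
  have F[measurable]: "?F \<in> borel_measurable (PiM {0..<Suc (Suc n)} (\<lambda>_. borel))"
    by measurable
  have "(\<integral>\<omega>. ?F \<omega> \<partial>path_measure K x) = (\<integral>\<omega>. ?F (restrict \<omega> {0..<Suc (Suc n)}) \<partial>path_measure K x)"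
    by (intro Bochner_Integration.integral_cong refl) (auto simp: Int_absorb1)
  also have "\<dots> = (\<integral>\<omega>. ?F \<omega> \<partial>C 0 (Suc (Suc n)) ?u)"
    by (rule path[OF F])
  also have "\<dots> = (\<integral>\<omega>. ?F \<omega> \<partial>(C 0 (Suc n) ?u \<bind> eP (Suc n)))"
    by simp
  also have "\<dots> = (\<integral>\<xi>. \<integral>\<omega>. ?F \<omega> \<partial>eP (Suc n) \<xi> \<partial>C 0 (Suc n) ?u)"
  proof (rule integral_bind_bounded[OF F])
    have ab: "0 \<le> a" "0 \<le> b" using G(2) h(2) abs_ge_zero order_trans by blast+
    show "\<bar>?F \<omega>\<bar> \<le> a * b" for \<omega>
      using G(2) h(2) ab by (auto simp: abs_mult intro!: mult_mono)
    show "eP (Suc n) \<in> C 0 (Suc n) ?u \<rightarrow>\<^sub>M subprob_algebra (PiM {0..<Suc (Suc n)} (\<lambda>_. borel))"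
      using measurable_eP[of "Suc n"] by (subst measurable_cong_sets[OF sets_C refl]) auto
    show "prob_space (C 0 (Suc n) ?u)"
      by (rule prob_space_C) simp
  qed
  also have "\<dots> = (\<integral>\<xi>. ?H \<xi> \<partial>C 0 (Suc n) ?u)"
  proof (rule Bochner_Integration.integral_cong[OF refl])
    fix \<xi> assume "\<xi> \<in> space (C 0 (Suc n) ?u)"
    then have \<xi>: "\<xi> \<in> space (PiM {0..<Suc n} (\<lambda>_. borel))"
      using space_C[of ?u 0 "Suc n"] by simp
    have "(\<integral>\<omega>. ?F \<omega> \<partial>eP (Suc n) \<xi>) = (\<integral>y. ?F (\<xi>(Suc n := y)) \<partial>K (\<xi> n))"
    proof -
      have *: "fun_upd \<xi> (Suc n) \<in> K (\<xi> n) \<rightarrow>\<^sub>M PiM {0..<Suc (Suc n)} (\<lambda>_. borel)"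
        using \<xi> by (intro measurable_fun_upd[where J="{0..<Suc n}"])
          (auto simp: measurable_cong_sets[OF sets_kernel[OF measurable_prob_algebraD[OF K]]])
      show ?thesis
        unfolding eP_def by (simp add: integral_distr[OF * F])
    qed
    also have "\<dots> = (\<integral>y. G \<xi> * h y \<partial>K (\<xi> n))"
    proof (rule Bochner_Integration.integral_cong[OF refl])
      fix y
      \<comment> \<open>A point of the product space is \<open>undefined\<close> off its index set,
        so cutting off the appended coordinate gives back \<open>\<xi>\<close> itself.\<close>
      have "restrict (\<xi>(Suc n := y)) {0..<Suc n} = \<xi>"
        using \<xi> by (auto simp: space_PiM PiE_def extensional_def fun_eq_iff restrict_def)
      then show "?F (\<xi>(Suc n := y)) = G \<xi> * h y" by simp
    qed
    finally show "(\<integral>\<omega>. ?F \<omega> \<partial>eP (Suc n) \<xi>) = ?H \<xi>" by simp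
  qed
  also have "\<dots> = (\<integral>\<omega>. ?H (restrict \<omega> {0..<Suc n}) \<partial>path_measure K x)"
    by (rule path[symmetric, OF H])
  finally show ?thesis by simp
qed

text \<open>The first coordinate is produced by one step of \<open>eP\<close> from the empty path,
  which is the constantly \<open>undefined\<close> function, and the kernel of that step is the
  point mass at \<open>x\<close>.\<close>

lemma integral_path_0:
  fixes h :: "'e :: topological_space \<Rightarrow> real"
  assumes K: "markov_kernel K" and h[measurable]: "h \<in> borel_measurable borel"
  shows "(\<integral>\<omega>. h (\<omega> 0) \<partial>path_measure K x) = h x"
proof -
  interpret Ionescu_Tulcea "chain_step K x" "\<lambda>_. borel"
    by (rule Ionescu_Tulcea_chain_step[OF K])
  let ?u = "\<lambda>_::nat. undefined :: 'e"
  have CI: "CI {0..<Suc 0} = eP 0 ?u"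
    using measurable_eP[of 0] by (simp only: CI_atLeast0LessThan C.simps) (simp add: bind_return)
  have r: "(\<lambda>\<omega>. restrict \<omega> {0..<Suc 0}) \<in> path_measure K x \<rightarrow>\<^sub>M PiM {0..<Suc 0} (\<lambda>_. borel)"
    by (simp add: measurable_cong_sets[OF sets_path_measure[OF K] refl] measurable_restrict_subset)
  have "(\<integral>\<omega>. h (\<omega> 0) \<partial>path_measure K x) = (\<integral>\<omega>. h (restrict \<omega> {0..<Suc 0} 0) \<partial>path_measure K x)"
    by simp
  also have "\<dots> = (\<integral>\<omega>. h (\<omega> 0) \<partial>CI {0..<Suc 0})"
    by (subst distr_path_measure[OF K, symmetric], simp, subst integral_distr[OF r]) auto
  also have "\<dots> = (\<integral>\<omega>. h (\<omega> 0) \<partial>distr (return borel x) (PiM {0..<Suc 0} (\<lambda>_. borel)) (fun_upd ?u 0))"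
    by (simp only: CI eP_def chain_step.simps)
  also have "\<dots> = (\<integral>y. h ((?u(0 := y)) 0) \<partial>return borel x)"
    by (rule integral_distr) (auto intro!: measurable_fun_upd[where J="{}"])
  also have "\<dots> = h x"
    by (simp add: integral_return)
  finally show ?thesis .
qed

section \<open>Kernel operators and the Poisson equation\<close>

text \<open>The Markov operator maps functions to functions, so that its iterates are plain
  \<open>funpow\<close> powers.\<close>

definition kernel_op :: "('e :: topological_space \<Rightarrow> 'e measure) \<Rightarrow> ('e \<Rightarrow> real) \<Rightarrow> 'e \<Rightarrow> real" where
  "kernel_op Q g x = (\<integral>y. g y \<partial>Q x)"

lemma
  assumes "markov_kernel Q"
  shows prob_space_kernel: "prob_space (Q x)" and sets_markov_kernel: "sets (Q x) = sets borel"
  using measurable_space[OF assms, of x] by (auto simp: space_prob_algebra)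

lemma kernel_op_measurable[measurable (raw)]:
  assumes Q: "markov_kernel Q" and g[measurable]: "g \<in> borel_measurable borel"
  shows "kernel_op Q g \<in> borel_measurable borel"
  unfolding kernel_op_def[abs_def] using measurable_prob_algebraD[OF Q] by measurable

lemma kernel_op_integrable:
  fixes g :: "'e :: topological_space \<Rightarrow> real"
  assumes Q: "markov_kernel Q" and g: "g \<in> borel_measurable borel" "\<And>x. \<bar>g x\<bar> \<le> b"
  shows "integrable (Q x) g"
proof -
  interpret prob_space "Q x" by (rule prob_space_kernel[OF Q])
  show ?thesis
    using g by (intro integrable_const_bound[of _ b])
      (auto simp: measurable_cong_sets[OF sets_markov_kernel[OF Q] refl])
qed

lemma kernel_op_const: "markov_kernel Q \<Longrightarrow> kernel_op Q (\<lambda>_. c) = (\<lambda>_. c)"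
  by (auto simp: kernel_op_def prob_space.prob_space[OF prob_space_kernel])

lemma kernel_op_mono:
  assumes "markov_kernel Q" "g \<in> borel_measurable borel" "\<And>x. \<bar>g x\<bar> \<le> b"
    "h \<in> borel_measurable borel" "\<And>x. \<bar>h x\<bar> \<le> b'" and "\<And>x. g x \<le> h x"
  shows "kernel_op Q g x \<le> kernel_op Q h x"
  unfolding kernel_op_def using assms by (intro integral_mono kernel_op_integrable) auto

lemma kernel_op_add:
  assumes "markov_kernel Q" "g \<in> borel_measurable borel" "\<And>x. \<bar>g x\<bar> \<le> b"
    "h \<in> borel_measurable borel" "\<And>x. \<bar>h x\<bar> \<le> b'"
  shows "kernel_op Q (\<lambda>x. g x + h x) = (\<lambda>x. kernel_op Q g x + kernel_op Q h x)"
  unfolding kernel_op_def fun_eq_iff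
  using assms by (auto intro!: Bochner_Integration.integral_add kernel_op_integrable)

lemma kernel_op_bounds:
  assumes Q: "markov_kernel Q" and g: "g \<in> borel_measurable borel" "\<And>x. a \<le> g x \<and> g x \<le> b"
  shows "a \<le> kernel_op Q g x \<and> kernel_op Q g x \<le> b"
proof -
  have gb: "\<bar>g x\<bar> \<le> max \<bar>a\<bar> \<bar>b\<bar>" for x using g(2)[of x] by (auto simp: abs_le_iff max_def)
  have "kernel_op Q (\<lambda>_. a) x \<le> kernel_op Q g x" "kernel_op Q g x \<le> kernel_op Q (\<lambda>_. b) x"
    using g gb by (auto intro!: kernel_op_mono[OF Q])
  then show ?thesis by (simp add: kernel_op_const[OF Q])
qed

lemma kernel_op_abs_le:
  assumes "markov_kernel Q" "g \<in> borel_measurable borel" "\<And>x. \<bar>g x\<bar> \<le> b"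
  shows "\<bar>kernel_op Q g x\<bar> \<le> b"
  using kernel_op_bounds[of Q g "-b" b x] assms by (auto simp: abs_le_iff minus_le_iff)

lemma kernel_op_pow_measurable[measurable (raw)]:
  assumes "markov_kernel Q" "g \<in> borel_measurable borel"
  shows "(kernel_op Q ^^ k) g \<in> borel_measurable borel"
  using assms by (induction k) (auto intro: kernel_op_measurable)

lemma kernel_op_pow_bounds:
  assumes "markov_kernel Q" "g \<in> borel_measurable borel" "\<And>x. a \<le> g x \<and> g x \<le> b"
  shows "a \<le> (kernel_op Q ^^ k) g x \<and> (kernel_op Q ^^ k) g x \<le> b"
  using assms
proof (induction k arbitrary: x)
  case (Suc k)
  then show ?case
    by (simp, intro kernel_op_bounds kernel_op_pow_measurable) auto
qed auto

lemma kernel_op_pow_abs_le: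
  assumes "markov_kernel Q" "g \<in> borel_measurable borel" "\<And>x. \<bar>g x\<bar> \<le> b"
  shows "\<bar>(kernel_op Q ^^ k) g x\<bar> \<le> b"
  using kernel_op_pow_bounds[of Q g "-b" b k x] assms by (auto simp: abs_le_iff minus_le_iff)

lemma kernel_op_pow_add:
  assumes "markov_kernel Q" "g \<in> borel_measurable borel" "\<And>x. \<bar>g x\<bar> \<le> b"
    "h \<in> borel_measurable borel" "\<And>x. \<bar>h x\<bar> \<le> b'"
  shows "(kernel_op Q ^^ k) (\<lambda>x. g x + h x) = (\<lambda>x. (kernel_op Q ^^ k) g x + (kernel_op Q ^^ k) h x)"
  by (induction k)
    (simp_all add: kernel_op_add[OF assms(1) kernel_op_pow_measurable[OF assms(1,2)]
      kernel_op_pow_abs_le[OF assms(1-3)] kernel_op_pow_measurable[OF assms(1,4)]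
      kernel_op_pow_abs_le[OF assms(1,4,5)]])

lemma kernel_op_pow_const: "markov_kernel Q \<Longrightarrow> (kernel_op Q ^^ k) (\<lambda>_. c) = (\<lambda>_. c)"
  by (induction k) (auto simp: kernel_op_const)

lemma kernel_op_pow_mono:
  assumes "markov_kernel Q" "g \<in> borel_measurable borel" "\<And>x. \<bar>g x\<bar> \<le> b"
    "h \<in> borel_measurable borel" "\<And>x. \<bar>h x\<bar> \<le> b'" and "\<And>x. g x \<le> h x"
  shows "(kernel_op Q ^^ k) g x \<le> (kernel_op Q ^^ k) h x"
  using assms(6)
proof (induction k arbitrary: x)
  case (Suc k)
  show ?case
    using assms(1-5) Suc
    by (simp, intro kernel_op_mono[where b = b and b' = b'] kernel_op_pow_measurable)
      (auto intro: kernel_op_pow_abs_le)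
qed auto

lemma markov_kernel_pow:
  fixes Q :: "'e :: topological_space \<Rightarrow> 'e measure"
  assumes Q: "markov_kernel Q" shows "markov_kernel (kernel_pow Q n)"
proof (induction n)
  case 0
  have "(\<lambda>x. return borel x) \<in> (borel :: 'e measure) \<rightarrow>\<^sub>M prob_algebra borel" by measurable
  then show ?case by (simp cong: measurable_cong)
next
  case (Suc n)
  have "(\<lambda>x. Q x \<bind> kernel_pow Q n) \<in> (borel :: 'e measure) \<rightarrow>\<^sub>M prob_algebra borel"
    by (rule measurable_bind_prob_space[OF Q Suc])
  then show ?case by (simp cong: measurable_cong)
qed

text \<open>Links the iterated kernels occurring in \<open>ME\<close> to operator powers. The
  recursions agree: \<open>kernel_pow\<close> takes its first step outermost, as
  \<open>funpow\<close> does.\<close>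

lemma integral_kernel_pow:
  assumes Q: "markov_kernel Q" and h: "h \<in> borel_measurable borel" "\<And>x. \<bar>h x\<bar> \<le> b"
  shows "(\<integral>y. h y \<partial>kernel_pow Q n x) = (kernel_op Q ^^ n) h x"
proof (induction n arbitrary: x)
  case 0
  then show ?case using h by (simp add: integral_return)
next
  case (Suc n)
  have "kernel_pow Q n \<in> Q x \<rightarrow>\<^sub>M subprob_algebra borel"
    using measurable_prob_algebraD[OF markov_kernel_pow[OF Q, of n]]
    by (simp add: measurable_cong_sets[OF sets_markov_kernel[OF Q] refl])
  then have "(\<integral>y. h y \<partial>kernel_pow Q (Suc n) x) = (\<integral>y. \<integral>z. h z \<partial>kernel_pow Q n y \<partial>Q x)"
    unfolding kernel_pow.simps
    by (intro integral_bind_bounded[OF h]) (auto intro: prob_space_kernel[OF Q])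
  then show ?case by (simp add: Suc kernel_op_def)
qed

section \<open>Dobrushin contraction and the Poisson equation\<close>

locale contracting_kernel =
  fixes Q :: "'e :: topological_space \<Rightarrow> 'e measure" and \<Delta> :: real
  assumes kernel: "markov_kernel Q"
    and \<Delta>: "0 \<le> \<Delta>" "\<Delta> < 1"
    and dobrushin: "B \<in> sets borel \<Longrightarrow> measure (Q x) B - measure (Q y) B \<le> \<Delta>"
begin

text \<open>\<open>\<Delta>\<close> bounds the Dobrushin coefficient of \<open>Q\<close>. Recentred
  at its infimum, \<open>g\<close> takes values in an interval of length \<open>c\<close>, and
  \<open>integral_diff_le\<close> applies on that interval.\<close>

lemma osc_kernel_op:
  assumes g: "g \<in> borel_measurable borel" "\<And>x. \<bar>g x\<bar> \<le> b" and osc: "\<And>x y. g x - g y \<le> c"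
  shows "kernel_op Q g x - kernel_op Q g y \<le> \<Delta> * c"
proof -
  define a where "a = (INF x. g x)"
  have "bdd_below (range g)" using g(2) by (intro bdd_belowI[of _ "-b"]) (auto simp: abs_le_iff minus_le_iff)
  then have 1: "a \<le> g x" for x unfolding a_def by (rule cINF_lower) simp
  have 2: "g x \<le> a + c" for x
  proof -
    have "g x - c \<le> a" unfolding a_def using osc by (intro cINF_greatest) (auto simp: algebra_simps)
    then show ?thesis by simp
  qed
  have "kernel_op Q g x - kernel_op Q g y \<le> \<Delta> * ((a + c) - a)"
    unfolding kernel_op_def using 1 2
    by (intro integral_diff_le[of _ _ borel] prob_space_kernel kernel sets_markov_kernel dobrushin g) auto
  then show ?thesis by simp
qed

lemma osc_kernel_op_pow:
  assumes f: "f \<in> borel_measurable borel" "\<And>x. \<bar>f x\<bar> \<le> M"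
  shows "(kernel_op Q ^^ k) f x - (kernel_op Q ^^ k) f y \<le> \<Delta> ^ k * (2 * M)"
proof (induction k arbitrary: x y)
  case 0
  then show ?case using f(2)[of x] f(2)[of y] by (simp add: abs_le_iff)
next
  case (Suc k)
  have "kernel_op Q ((kernel_op Q ^^ k) f) x - kernel_op Q ((kernel_op Q ^^ k) f) y \<le> \<Delta> * (\<Delta> ^ k * (2 * M))"
    using f kernel by (intro osc_kernel_op[where b = M] Suc kernel_op_pow_measurable kernel_op_pow_abs_le)
  then show ?case by (simp add: mult_ac)
qed

text \<open>Averaging never leaves the range of the function averaged. All later iterates therefore
  stay within the range of the \<open>k\<close>-th one, whose length decays geometrically.\<close>

lemma ergodic_limit:
  assumes f: "f \<in> borel_measurable borel" "\<And>x. \<bar>f x\<bar> \<le> M"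
  obtains \<rho> where "\<And>k x. \<bar>(kernel_op Q ^^ k) f x - \<rho>\<bar> \<le> \<Delta> ^ k * (2 * M)"
proof -
  let ?g = "\<lambda>k. (kernel_op Q ^^ k) f"
  \<comment> \<open>The two iterates are compared at different points, which is why the limit found
    at the single point \<open>undefined\<close> serves for every \<open>x\<close>.\<close>
  have close: "\<bar>?g (j + k) y - ?g k x\<bar> \<le> \<Delta> ^ k * (2 * M)" for j k x y
  proof -
    have "?g k x - \<Delta> ^ k * (2 * M) \<le> (kernel_op Q ^^ j) (?g k) y \<and>
      (kernel_op Q ^^ j) (?g k) y \<le> ?g k x + \<Delta> ^ k * (2 * M)"
    proof (rule kernel_op_pow_bounds[OF kernel kernel_op_pow_measurable[OF kernel f(1)]])
      show "?g k x - \<Delta> ^ k * (2 * M) \<le> ?g k z \<and> ?g k z \<le> ?g k x + \<Delta> ^ k * (2 * M)" for z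
        using osc_kernel_op_pow[OF f, of k x z] osc_kernel_op_pow[OF f, of k z x] by simp
    qed
    then show ?thesis by (simp add: funpow_add abs_le_iff)
  qed
  have lim0: "(\<lambda>k. \<Delta> ^ k * (2 * M)) \<longlonglongrightarrow> 0"
    using \<Delta> by (intro tendsto_mult_left_zero LIMSEQ_realpow_zero)
  have "Cauchy (\<lambda>k. ?g k undefined)"
  proof (rule CauchyI')
    fix e :: real assume "e > 0"
    then have "eventually (\<lambda>k. \<Delta> ^ k * (2 * M) < e) sequentially"
      using order_tendstoD(2)[OF lim0] by auto
    then obtain N where N: "\<Delta> ^ k * (2 * M) < e" if "k \<ge> N" for k
      by (auto simp: eventually_sequentially)
    have "dist (?g m undefined) (?g n undefined) < e" if "m \<ge> N" "n > m" for m n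
      using close[of "n - m" m undefined undefined] N[of m] that by (simp add: dist_real_def)
    then show "\<exists>N. \<forall>m\<ge>N. \<forall>n>m. dist (?g m undefined) (?g n undefined) < e" by blast
  qed
  then obtain \<rho> where \<rho>: "(\<lambda>k. ?g k undefined) \<longlonglongrightarrow> \<rho>"
    by (auto simp: Cauchy_convergent_iff convergent_def)
  show ?thesis
  proof (rule that[of \<rho>])
    fix k x
    have "(\<lambda>j. \<bar>?g k x - ?g (j + k) undefined\<bar>) \<longlonglongrightarrow> \<bar>?g k x - \<rho>\<bar>"
      by (intro tendsto_intros LIMSEQ_ignore_initial_segment \<rho>)
    then show "\<bar>?g k x - \<rho>\<bar> \<le> \<Delta> ^ k * (2 * M)"
      using close by (intro LIMSEQ_le_const2) (auto simp: abs_minus_commute)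
  qed
qed

text \<open>\<open>w\<close> is the sum of the centred iterates \<open>g k\<close>. Geometric
  domination allows \<open>Q\<close> to be applied termwise, which shifts the series by one index,
  so that only its head survives in \<open>w - Q w\<close>. The bound on \<open>w\<close> involves
  \<open>M\<close> and \<open>\<Delta>\<close> alone.\<close>

lemma poisson:
  assumes f: "f \<in> borel_measurable borel" "\<And>x. \<bar>f x\<bar> \<le> M"
  obtains \<rho> w where "\<And>x. (\<lambda>k. (kernel_op Q ^^ k) f x) \<longlonglongrightarrow> \<rho>"
    "w \<in> borel_measurable borel" "\<And>x. \<bar>w x\<bar> \<le> 2 * M / (1 - \<Delta>)"
    "\<And>x. w x - kernel_op Q w x = f x - \<rho>"
proof -
  obtain \<rho> where \<rho>: "\<bar>(kernel_op Q ^^ k) f x - \<rho>\<bar> \<le> \<Delta> ^ k * (2 * M)" for k x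
    using ergodic_limit[OF f] by metis
  have lim0: "(\<lambda>k. \<Delta> ^ k * (2 * M)) \<longlonglongrightarrow> 0"
    using \<Delta> by (intro tendsto_mult_left_zero LIMSEQ_realpow_zero)
  define g where "g k x = (kernel_op Q ^^ k) f x - \<rho>" for k x
  define w where "w x = (\<Sum>k. g k x)" for x
  note [measurable] = f(1) kernel
  have gm[measurable]: "g k \<in> borel_measurable borel" for k
    unfolding g_def using kernel_op_pow_measurable[OF kernel f(1), of k] by simp
  have gb: "\<bar>g k x\<bar> \<le> \<Delta> ^ k * (2 * M)" for k x
    unfolding g_def by (rule \<rho>)
  have geo: "(\<lambda>k. \<Delta> ^ k * (2 * M)) sums (1 / (1 - \<Delta>) * (2 * M))"
    using \<Delta> by (intro sums_mult2 geometric_sums) auto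
  have sg: "summable (\<lambda>k. \<bar>g k x\<bar>)" for x
    using gb by (intro summable_comparison_test[OF _ sums_summable[OF geo]]) auto
  have wb: "\<bar>w x\<bar> \<le> 2 * M / (1 - \<Delta>)" for x
  proof -
    have "\<bar>w x\<bar> \<le> (\<Sum>k. \<bar>g k x\<bar>)" unfolding w_def by (rule summable_rabs[OF sg])
    also have "\<dots> \<le> (\<Sum>k. \<Delta> ^ k * (2 * M))"
      by (rule suminf_le[OF gb sg sums_summable[OF geo]])
    finally show ?thesis using sums_unique[OF geo] by simp
  qed
  have gi: "integrable (Q x) (g k)" for k x
    by (rule kernel_op_integrable[OF kernel gm gb])
  have "kernel_op Q w x = (\<Sum>k. kernel_op Q (g k) x)" for x
    unfolding kernel_op_def w_def
  proof (rule integral_suminf)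
    show "AE y in Q x. summable (\<lambda>k. norm (g k y))" using sg by simp
    have "norm (\<integral>y. norm (g k y) \<partial>Q x) \<le> \<Delta> ^ k * (2 * M)" for k
      using kernel_op_bounds[OF kernel, of "\<lambda>y. \<bar>g k y\<bar>" 0 "\<Delta> ^ k * (2 * M)" x] gb[of k]
      by (simp add: kernel_op_def)
    then show "summable (\<lambda>k. \<integral>y. norm (g k y) \<partial>Q x)"
      by (intro summable_comparison_test[OF _ sums_summable[OF geo]]) auto
  qed (rule gi)
  moreover have "kernel_op Q (g k) x = g (Suc k) x" for k x
    using kernel_op_add[OF kernel kernel_op_pow_measurable[OF kernel f(1), of k]
        kernel_op_pow_abs_le[OF kernel f], of "\<lambda>_. - \<rho>" "\<bar>\<rho>\<bar>"]
    by (simp add: g_def[abs_def] kernel_op_const[OF kernel])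
  ultimately have "w x - kernel_op Q w x = g 0 x" for x
    using suminf_split_head[OF summable_rabs_cancel[OF sg], of x] by (simp add: w_def)
  then have "w x - kernel_op Q w x = f x - \<rho>" for x by (simp add: g_def)
  moreover have "(\<lambda>k. (kernel_op Q ^^ k) f x) \<longlonglongrightarrow> \<rho>" for x
    using Lim_null_comparison[OF _ lim0, of "\<lambda>k. (kernel_op Q ^^ k) f x - \<rho>"] \<rho>
    by (auto simp: LIM_zero_iff)
  moreover have "w \<in> borel_measurable borel" unfolding w_def by measurable
  ultimately show ?thesis using that wb by blast
qed

end

section \<open>Exponential moments of the cost\<close>

text \<open>The lower bound is Jensen's inequality for the exponential, the upper one Hoeffding's
  lemma on \<open>[-W, W]\<close>.\<close>

lemma integral_exp_bounds:
  fixes w :: "'a \<Rightarrow> real"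
  assumes M: "prob_space M" and w[measurable]: "w \<in> borel_measurable M" and W: "\<And>x. \<bar>w x\<bar> \<le> W"
  shows "exp (\<alpha> * (\<integral>x. w x \<partial>M)) \<le> (\<integral>x. exp (\<alpha> * w x) \<partial>M)"
    and "(\<integral>x. exp (\<alpha> * w x) \<partial>M) \<le> exp (\<alpha> * (\<integral>x. w x \<partial>M) + \<alpha>\<^sup>2 * W\<^sup>2 / 2)"
proof -
  interpret prob_space M by fact
  have int: "integrable M w" using W by (intro integrable_const_bound[of _ W]) auto
  have ew: "exp (\<alpha> * w x) \<le> exp (\<bar>\<alpha>\<bar> * W)" for x
  proof -
    have "\<alpha> * w x \<le> \<bar>\<alpha>\<bar> * \<bar>w x\<bar>" by (simp flip: abs_mult)
    also have "\<dots> \<le> \<bar>\<alpha>\<bar> * W" using W by (intro mult_left_mono) auto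
    finally show ?thesis by simp
  qed
  then have inte: "integrable M (\<lambda>x. exp (\<alpha> * w x))"
    by (intro integrable_const_bound[of _ "exp (\<bar>\<alpha>\<bar> * W)"]) auto
  let ?c = "\<alpha> * (\<integral>x. w x \<partial>M)"
  \<comment> \<open>The tangent to the exponential at the mean \<open>?c\<close> lies below its
    graph; integrating the tangent leaves \<open>exp ?c\<close>.\<close>
  have "exp ?c * (1 + (\<alpha> * w x - ?c)) \<le> exp (\<alpha> * w x)" for x
    using mult_left_mono[OF exp_ge_add_one_self[of "\<alpha> * w x - ?c"], of "exp ?c"]
    by (simp flip: exp_add)
  then have "(\<integral>x. exp ?c * (1 + (\<alpha> * w x - ?c)) \<partial>M) \<le> (\<integral>x. exp (\<alpha> * w x) \<partial>M)"
    using int inte by (intro integral_mono) auto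
  then show "exp ?c \<le> (\<integral>x. exp (\<alpha> * w x) \<partial>M)"
    using int by (simp add: prob_space)
  \<comment> \<open>Stated for positive \<open>l\<close>; negative \<open>\<alpha>\<close> is
    covered by passing to \<open>- \<alpha>\<close> and \<open>- w\<close>. The interval has length
    \<open>2 * W\<close>, and \<open>(2 * W)^2 / 8 = W^2 / 2\<close>.\<close>
  have hoeffding: "(\<integral>x. exp (l * v x) \<partial>M) \<le> exp (l * expectation v + l\<^sup>2 * W\<^sup>2 / 2)"
    if l: "l > 0" and [measurable]: "v \<in> borel_measurable M" and v: "\<And>x. \<bar>v x\<bar> \<le> W"
      and intv: "integrable M (\<lambda>x. exp (l * v x))" for l and v :: "'a \<Rightarrow> real"
  proof -
    interpret v: interval_bounded_random_variable M v "-W" W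
      using v by unfold_locales (auto simp: abs_le_iff minus_le_iff)
    have i: "integrable M (\<lambda>x. exp (l * (v x - expectation v)))"
      using integrable_mult_left[OF intv, of "exp (- (l * expectation v))"]
      by (simp add: algebra_simps flip: exp_add)
    have "ennreal (\<integral>x. exp (l * (v x - expectation v)) \<partial>M) \<le> ennreal (exp (l\<^sup>2 * (W - - W)\<^sup>2 / 8))"
      using v.Hoeffdings_lemma_nn_integral[OF l] i by (simp add: nn_integral_eq_integral)
    then have "(\<integral>x. exp (l * (v x - expectation v)) \<partial>M) \<le> exp (l\<^sup>2 * W\<^sup>2 / 2)"
      by (simp add: ennreal_le_iff power2_eq_square mult_ac)
    then have "exp (l * expectation v) * (\<integral>x. exp (l * (v x - expectation v)) \<partial>M) \<le>
        exp (l * expectation v) * exp (l\<^sup>2 * W\<^sup>2 / 2)"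
      by simp
    also have "exp (l * expectation v) * (\<integral>x. exp (l * (v x - expectation v)) \<partial>M) =
        (\<integral>x. exp (l * v x) \<partial>M)"
      by (subst integral_mult_right_zero[symmetric]) (simp add: algebra_simps flip: exp_add)
    finally show ?thesis by (simp add: exp_add)
  qed
  show "(\<integral>x. exp (\<alpha> * w x) \<partial>M) \<le> exp (?c + \<alpha>\<^sup>2 * W\<^sup>2 / 2)"
  proof (cases \<alpha> "0 :: real" rule: linorder_cases)
    case less
    then show ?thesis using hoeffding[of "- \<alpha>" "\<lambda>x. - w x"] W inte by simp
  next
    case equal
    then show ?thesis by (simp add: prob_space)
  next
    case greater
    then show ?thesis using hoeffding[of \<alpha> w] W inte by simp
  qed
qed

lemma exp_mult_le:
  fixes a b :: real
  assumes "\<bar>b\<bar> \<le> c" shows "exp (- \<bar>a\<bar> * c) \<le> exp (a * b)" "exp (a * b) \<le> exp (\<bar>a\<bar> * c)"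
proof -
  have "\<bar>a * b\<bar> \<le> \<bar>a\<bar> * c" using assms by (simp add: abs_mult mult_left_mono)
  then show "exp (- \<bar>a\<bar> * c) \<le> exp (a * b)" "exp (a * b) \<le> exp (\<bar>a\<bar> * c)" by (auto simp: abs_le_iff)
qed

section \<open>Cost estimates from a solution of the Poisson equation\<close>

locale poisson_solution =
  fixes Q :: "'e :: topological_space \<Rightarrow> 'e measure" and f w :: "'e \<Rightarrow> real" and \<rho> M W :: real
  assumes kernel: "markov_kernel Q"
    and f: "f \<in> borel_measurable borel" "\<bar>f x\<bar> \<le> M"
    and w: "w \<in> borel_measurable borel" "\<bar>w x\<bar> \<le> W"
    and poisson: "w x - kernel_op Q w x = f x - \<rho>"
begin

lemma prob_space_path: "prob_space (path_measure Q x)"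
  by (rule prob_space_path_measure[OF kernel])

lemma measurable_path_component: "(\<lambda>\<omega>. \<omega> i) \<in> path_measure Q x \<rightarrow>\<^sub>M borel"
  by (simp add: measurable_cong_sets[OF sets_path_measure[OF kernel] refl] measurable_component_singleton)

text \<open>The integrand is a martingale in \<open>n\<close>: the Poisson equation turns the
  conditional mean of the next value of \<open>w\<close> into \<open>w - (f - \<rho>)\<close>, which
  cancels the newly added cost. At \<open>n = 0\<close> only \<open>w x\<close> is present.\<close>

lemma integral_path_centered_cost:
  "(\<integral>\<omega>. (\<Sum>i<n. f (\<omega> i) - \<rho>) + w (\<omega> n) \<partial>path_measure Q x) = w x"
proof -
  interpret prob_space "path_measure Q x" by (rule prob_space_path)
  note [measurable] = measurable_path_component[of _ x] f(1) w(1)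
  have if': "integrable (path_measure Q x) (\<lambda>\<omega>. f (\<omega> i))" for i
    using f by (intro integrable_const_bound[of _ M]) auto
  have iw: "integrable (path_measure Q x) (\<lambda>\<omega>. w (\<omega> i))" for i
    using w by (intro integrable_const_bound[of _ W]) auto
  show ?thesis
  proof (induction n)
    case 0
    then show ?case by (simp add: integral_path_0[OF kernel w(1)])
  next
    case (Suc n)
    have "expectation (\<lambda>\<omega>. w (\<omega> (Suc n))) = expectation (\<lambda>\<omega>. kernel_op Q w (\<omega> n))"
      using integral_path_Suc[OF kernel _ _ w, of "\<lambda>_. 1" n 1 x] by (simp add: kernel_op_def)
    also have "\<dots> = expectation (\<lambda>\<omega>. w (\<omega> n) - (f (\<omega> n) - \<rho>))"
      by (intro Bochner_Integration.integral_cong refl) (simp flip: poisson)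
    finally show ?case using Suc if' iw by (simp add: prob_space)
  qed
qed

text \<open>One \<open>W\<close> pays for the initial value \<open>w x\<close> and one for the
  terminal mean of \<open>w\<close>, whatever \<open>n\<close> is.\<close>

lemma average_bounds:
  "\<bar>(\<integral>\<omega>. (\<Sum>i<n. f (\<omega> i)) \<partial>path_measure Q x) - real n * \<rho>\<bar> \<le> 2 * W"
proof -
  interpret prob_space "path_measure Q x" by (rule prob_space_path)
  note [measurable] = measurable_path_component[of _ x] f(1) w(1)
  have if': "integrable (path_measure Q x) (\<lambda>\<omega>. f (\<omega> i))" for i
    using f by (intro integrable_const_bound[of _ M]) auto
  have iw: "integrable (path_measure Q x) (\<lambda>\<omega>. w (\<omega> i))" for i
    using w by (intro integrable_const_bound[of _ W]) auto
  have "\<bar>expectation (\<lambda>\<omega>. w (\<omega> n))\<bar> \<le> W"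
    using w by (intro order_trans[OF integral_abs_bound] integral_le_const) (auto intro: iw)
  moreover have "\<bar>w x\<bar> \<le> W" by (rule w)
  moreover have "(\<integral>\<omega>. (\<Sum>i<n. f (\<omega> i)) \<partial>path_measure Q x) - real n * \<rho> + expectation (\<lambda>\<omega>. w (\<omega> n)) = w x"
    using integral_path_centered_cost[where n = n and x = x] if' iw by (simp add: prob_space sum_subtractf)
  ultimately show ?thesis by linarith
qed

lemma average_limit:
  "(\<lambda>n. 1 / real n * (\<integral>\<omega>. (\<Sum>i<n. f (\<omega> i)) \<partial>path_measure Q x)) \<longlonglongrightarrow> \<rho>"
proof -
  let ?A = "\<lambda>n. \<integral>\<omega>. (\<Sum>i<n. f (\<omega> i)) \<partial>path_measure Q x"
  have "(\<lambda>n. 1 / real n * ?A n - \<rho>) \<longlonglongrightarrow> 0"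
  proof (rule Lim_null_comparison)
    show "(\<lambda>n. 2 * W * (1 / real n)) \<longlonglongrightarrow> 0"
      by (intro tendsto_mult_right_zero lim_1_over_n)
    show "\<forall>\<^sub>F n in sequentially. norm (1 / real n * ?A n - \<rho>) \<le> 2 * W * (1 / real n)"
      using eventually_gt_at_top[of 0]
    proof eventually_elim
      case (elim n)
      then have "1 / real n * ?A n - \<rho> = (?A n - real n * \<rho>) / real n" by (simp add: field_simps)
      then show ?case using average_bounds[where n = n and x = x] elim by (simp add: divide_right_mono)
    qed
  qed
  then show ?thesis by (simp add: LIM_zero_iff)
qed

text \<open>The exponential moment of the martingale of \<open>integral_path_centered_cost\<close>,
  kept as a product so that the Markov property can act on the second factor.\<close>

definition tilted :: "real \<Rightarrow> nat \<Rightarrow> 'e \<Rightarrow> real" where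
  "tilted \<alpha> n x = (\<integral>\<omega>. exp (\<alpha> * (\<Sum>i<n. f (\<omega> i) - \<rho>)) * exp (\<alpha> * w (\<omega> n)) \<partial>path_measure Q x)"

lemma exp_cost_le:
  "exp (\<alpha> * (\<Sum>i<n. f (\<omega> i) - \<rho>)) \<le> exp (\<bar>\<alpha>\<bar> * (real n * (M + \<bar>\<rho>\<bar>)))"
proof (rule exp_mult_le)
  have "\<bar>\<Sum>i<n. f (\<omega> i) - \<rho>\<bar> \<le> (\<Sum>i<n. M + \<bar>\<rho>\<bar>)"
  proof (rule order_trans[OF sum_abs sum_mono])
    show "\<bar>f (\<omega> i) - \<rho>\<bar> \<le> M + \<bar>\<rho>\<bar>" for i using f(2)[of "\<omega> i"] by linarith
  qed
  then show "\<bar>\<Sum>i<n. f (\<omega> i) - \<rho>\<bar> \<le> real n * (M + \<bar>\<rho>\<bar>)" by simp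
qed

lemma integrable_exp_cost:
  assumes h[measurable]: "h \<in> borel_measurable borel" and b: "\<And>y. \<bar>h y\<bar> \<le> b"
  shows "integrable (path_measure Q x) (\<lambda>\<omega>. exp (\<alpha> * (\<Sum>i<n. f (\<omega> i) - \<rho>)) * h (\<omega> k))"
proof -
  interpret prob_space "path_measure Q x" by (rule prob_space_path)
  note [measurable] = measurable_path_component[of _ x] f(1) w(1)
  show ?thesis
    by (intro integrable_const_bound[of _ "exp (\<bar>\<alpha>\<bar> * (real n * (M + \<bar>\<rho>\<bar>))) * b"])
      (auto simp only: real_norm_def abs_mult abs_exp_cancel exp_ge_zero abs_ge_zero
        intro!: AE_I2 mult_mono exp_cost_le b, measurable)
qed

lemma exp_w: "(\<lambda>y. exp (\<alpha> * w y)) \<in> borel_measurable borel" "\<bar>exp (\<alpha> * w y)\<bar> \<le> exp (\<bar>\<alpha>\<bar> * W)"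
  using w exp_mult_le(2)[OF w(2)] by simp_all

text \<open>Conditioning replaces the last factor by \<open>Q\<close> applied to
  \<open>exp (\<alpha> * w)\<close>, which \<open>integral_exp_bounds\<close> compares with
  \<open>exp (\<alpha> * Q w)\<close>. By the Poisson equation the latter combines with the newest
  cost term into the integrand at time \<open>n\<close>.\<close>

lemma tilted_Suc:
  "tilted \<alpha> n x \<le> tilted \<alpha> (Suc n) x" (is ?lower)
  "tilted \<alpha> (Suc n) x \<le> exp (\<alpha>\<^sup>2 * W\<^sup>2 / 2) * tilted \<alpha> n x" (is ?upper)
proof -
  let ?G = "\<lambda>n \<omega>. exp (\<alpha> * (\<Sum>i<n. f (\<omega> i) - \<rho>))" and ?h = "\<lambda>y. exp (\<alpha> * w y)"
  let ?E = "\<lambda>F. \<integral>\<omega>. F \<omega> \<partial>path_measure Q x"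
  have Gm: "?G (Suc n) \<in> borel_measurable (PiM {0..<Suc n} (\<lambda>_. borel))"
    using f(1) by measurable
  have "?E (\<lambda>\<omega>. ?G (Suc n) \<omega> * ?h (\<omega> (Suc n))) = ?E (\<lambda>\<omega>. ?G (Suc n) \<omega> * kernel_op Q ?h (\<omega> n))"
    using integral_path_Suc[OF kernel Gm _ exp_w(1)[of \<alpha>] exp_w(2), where x = x]
      exp_cost_le[of \<alpha> _ "Suc n"]
    by (auto simp: kernel_op_def simp del: exp_le_cancel_iff)
  then have step: "tilted \<alpha> (Suc n) x = ?E (\<lambda>\<omega>. ?G (Suc n) \<omega> * kernel_op Q ?h (\<omega> n))"
    by (simp add: tilted_def)
  have Qw: "kernel_op Q w y = w y - (f y - \<rho>)" for y by (simp flip: poisson)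
  have pQ: "prob_space (Q y)" "w \<in> borel_measurable (Q y)" for y
    using prob_space_kernel[OF kernel] w(1)
    by (auto simp: measurable_cong_sets[OF sets_markov_kernel[OF kernel] refl])
  have G: "?G (Suc n) \<omega> * exp (\<alpha> * kernel_op Q w (\<omega> n)) = ?G n \<omega> * ?h (\<omega> n)" for \<omega>
    by (simp add: Qw algebra_simps flip: exp_add)
  have 1: "?G n \<omega> * ?h (\<omega> n) \<le> ?G (Suc n) \<omega> * kernel_op Q ?h (\<omega> n)" for \<omega>
    using integral_exp_bounds(1)[OF pQ[of "\<omega> n"] w(2), of \<alpha>]
    unfolding G[symmetric] by (intro mult_left_mono) (auto simp: kernel_op_def)
  have 2: "?G (Suc n) \<omega> * kernel_op Q ?h (\<omega> n) \<le> exp (\<alpha>\<^sup>2 * W\<^sup>2 / 2) * (?G n \<omega> * ?h (\<omega> n))" for \<omega>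
  proof -
    have "kernel_op Q ?h (\<omega> n) \<le> exp (\<alpha>\<^sup>2 * W\<^sup>2 / 2) * exp (\<alpha> * kernel_op Q w (\<omega> n))"
      using integral_exp_bounds(2)[OF pQ[of "\<omega> n"] w(2), of \<alpha>] by (simp add: kernel_op_def exp_add mult_ac)
    then have "?G (Suc n) \<omega> * kernel_op Q ?h (\<omega> n) \<le>
        ?G (Suc n) \<omega> * (exp (\<alpha>\<^sup>2 * W\<^sup>2 / 2) * exp (\<alpha> * kernel_op Q w (\<omega> n)))"
      by (intro mult_left_mono) auto
    also have "\<dots> = exp (\<alpha>\<^sup>2 * W\<^sup>2 / 2) * (?G (Suc n) \<omega> * exp (\<alpha> * kernel_op Q w (\<omega> n)))"
      by (rule mult.left_commute)
    finally show ?thesis unfolding G .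
  qed
  have i1: "integrable (path_measure Q x) (\<lambda>\<omega>. ?G n \<omega> * ?h (\<omega> n))"
    by (rule integrable_exp_cost[OF exp_w])
  have i2: "integrable (path_measure Q x) (\<lambda>\<omega>. ?G (Suc n) \<omega> * kernel_op Q ?h (\<omega> n))"
    by (rule integrable_exp_cost[OF kernel_op_measurable[OF kernel exp_w(1)] kernel_op_abs_le[OF kernel exp_w]])
  show ?lower unfolding step unfolding tilted_def by (rule integral_mono[OF i1 i2 1])
  have "tilted \<alpha> (Suc n) x \<le> ?E (\<lambda>\<omega>. exp (\<alpha>\<^sup>2 * W\<^sup>2 / 2) * (?G n \<omega> * ?h (\<omega> n)))"
    unfolding step by (rule integral_mono[OF i2 integrable_mult_right[OF i1] 2])
  then show ?upper by (simp add: tilted_def)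
qed

lemma tilted_bounds:
  "exp (\<alpha> * w x) \<le> tilted \<alpha> n x \<and> tilted \<alpha> n x \<le> exp (real n * (\<alpha>\<^sup>2 * W\<^sup>2 / 2)) * exp (\<alpha> * w x)"
proof (induction n)
  case 0
  show ?case using integral_path_0[OF kernel exp_w(1), of x \<alpha>] by (simp add: tilted_def)
next
  case (Suc n)
  have "tilted \<alpha> (Suc n) x \<le> exp (\<alpha>\<^sup>2 * W\<^sup>2 / 2) * (exp (real n * (\<alpha>\<^sup>2 * W\<^sup>2 / 2)) * exp (\<alpha> * w x))"
    using Suc by (intro order_trans[OF tilted_Suc(2)] mult_left_mono) auto
  also have "\<dots> = exp (real (Suc n) * (\<alpha>\<^sup>2 * W\<^sup>2 / 2)) * exp (\<alpha> * w x)"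
    by (simp add: algebra_simps flip: exp_add)
  finally show ?case using Suc tilted_Suc(1)[of \<alpha> n x] by linarith
qed

text \<open>Dropping the factor \<open>exp (\<alpha> * w)\<close> at time \<open>n\<close> and
  estimating it at time 0 costs \<open>\<bar>\<alpha>\<bar> * W\<close> each on the logarithmic
  scale; the growth of \<open>tilted\<close> accounts for the term linear in
  \<open>n\<close>.\<close>

lemma log_moment_bounds:
  "\<bar>ln (\<integral>\<omega>. exp (\<alpha> * (\<Sum>i<n. f (\<omega> i))) \<partial>path_measure Q x) - real n * (\<alpha> * \<rho>)\<bar>
    \<le> 2 * (\<bar>\<alpha>\<bar> * W) + real n * (\<alpha>\<^sup>2 * W\<^sup>2 / 2)"
proof -
  let ?G = "\<lambda>\<omega>. exp (\<alpha> * (\<Sum>i<n. f (\<omega> i) - \<rho>))" and ?h = "\<lambda>y. exp (\<alpha> * w y)"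
  let ?E = "\<lambda>F. \<integral>\<omega>. F \<omega> \<partial>path_measure Q x"
  define Z where "Z = ?E (\<lambda>\<omega>. exp (\<alpha> * (\<Sum>i<n. f (\<omega> i))))"
  have iG: "integrable (path_measure Q x) ?G"
    using integrable_exp_cost[of "\<lambda>_. 1" 1 x \<alpha> n] by simp
  have ih: "integrable (path_measure Q x) (\<lambda>\<omega>. ?G \<omega> * ?h (\<omega> n))"
    by (rule integrable_exp_cost[OF exp_w])
  have "?E ?G = ?E (\<lambda>\<omega>. exp (- (real n * (\<alpha> * \<rho>))) * exp (\<alpha> * (\<Sum>i<n. f (\<omega> i))))"
    by (intro Bochner_Integration.integral_cong refl)
      (simp add: sum_subtractf algebra_simps flip: exp_add)
  then have EG: "?E ?G = exp (- (real n * (\<alpha> * \<rho>))) * Z"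
    by (simp add: Z_def)
  have "?E (\<lambda>\<omega>. ?G \<omega> * exp (- \<bar>\<alpha>\<bar> * W)) \<le> tilted \<alpha> n x"
    unfolding tilted_def using exp_mult_le(1)[OF w(2)]
    by (intro integral_mono integrable_mult_left iG ih mult_left_mono) auto
  then have up: "?E ?G * exp (- \<bar>\<alpha>\<bar> * W) \<le> tilted \<alpha> n x" by simp
  have "tilted \<alpha> n x \<le> ?E (\<lambda>\<omega>. ?G \<omega> * exp (\<bar>\<alpha>\<bar> * W))"
    unfolding tilted_def using exp_mult_le(2)[OF w(2)]
    by (intro integral_mono integrable_mult_left iG ih mult_left_mono) auto
  then have lo: "tilted \<alpha> n x \<le> ?E ?G * exp (\<bar>\<alpha>\<bar> * W)" by simp
  have 1: "exp (- \<bar>\<alpha>\<bar> * W) \<le> ?E ?G * exp (\<bar>\<alpha>\<bar> * W)"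
    using exp_mult_le(1)[OF w(2)[of x], of \<alpha>] tilted_bounds[of \<alpha> x n] lo by linarith
  have 2: "?E ?G * exp (- \<bar>\<alpha>\<bar> * W) \<le> exp (real n * (\<alpha>\<^sup>2 * W\<^sup>2 / 2)) * exp (\<bar>\<alpha>\<bar> * W)"
    using up tilted_bounds[of \<alpha> x n]
      mult_left_mono[OF exp_mult_le(2)[OF w(2)[of x], of \<alpha>] exp_ge_zero[of "real n * (\<alpha>\<^sup>2 * W\<^sup>2 / 2)"]]
    by linarith
  \<comment> \<open>The lower bound also yields the strict positivity that the logarithms below
    require.\<close>
  have "0 < ?E ?G * exp (\<bar>\<alpha>\<bar> * W)" using 1 by (rule less_le_trans[rotated]) simp
  then have pos: "0 < ?E ?G" by (simp add: zero_less_mult_iff)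
  then have Zpos: "0 < Z" by (simp add: EG zero_less_mult_iff)
  have lnG: "ln (?E ?G) = ln Z - real n * (\<alpha> * \<rho>)"
    using Zpos by (simp add: EG ln_mult)
  have "ln (exp (- \<bar>\<alpha>\<bar> * W)) \<le> ln (?E ?G * exp (\<bar>\<alpha>\<bar> * W))"
    using 1 pos by (subst ln_le_cancel_iff) auto
  then have "- (2 * (\<bar>\<alpha>\<bar> * W)) \<le> ln (?E ?G)" using pos by (simp add: ln_mult mult_ac)
  moreover have "ln (?E ?G * exp (- \<bar>\<alpha>\<bar> * W)) \<le> ln (exp (real n * (\<alpha>\<^sup>2 * W\<^sup>2 / 2)) * exp (\<bar>\<alpha>\<bar> * W))"
    using 2 pos by (subst ln_le_cancel_iff) auto
  then have "ln (?E ?G) \<le> 2 * (\<bar>\<alpha>\<bar> * W) + real n * (\<alpha>\<^sup>2 * W\<^sup>2 / 2)"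
    using pos by (simp add: ln_mult mult_ac)
  \<comment> \<open>Jensen's inequality loses nothing, so the lower estimate has no quadratic term;
    adding a nonnegative one makes the two estimates symmetric.\<close>
  moreover have "0 \<le> real n * (\<alpha>\<^sup>2 * W\<^sup>2 / 2)" by simp
  ultimately show ?thesis unfolding lnG Z_def[symmetric] by linarith
qed

text \<open>Division by \<open>n\<close> removes the boundary terms in the limit, while the
  quadratic term survives. The comparison sequences converge, so their \<open>liminf\<close> is
  their limit.\<close>

lemma liminf_log_moment_bounds:
  fixes x :: 'e and \<alpha> :: real
  defines "I \<equiv> liminf (\<lambda>n. ereal (1 / real n *
    ln (\<integral>\<omega>. exp (\<alpha> * (\<Sum>i<n. f (\<omega> i))) \<partial>path_measure Q x)))"
  shows "ereal (\<alpha> * \<rho> - \<alpha>\<^sup>2 * W\<^sup>2 / 2) \<le> I" "I \<le> ereal (\<alpha> * \<rho> + \<alpha>\<^sup>2 * W\<^sup>2 / 2)"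
proof -
  let ?Z = "\<lambda>n. ln (\<integral>\<omega>. exp (\<alpha> * (\<Sum>i<n. f (\<omega> i))) \<partial>path_measure Q x)"
  let ?r = "\<lambda>n. 2 * (\<bar>\<alpha>\<bar> * W) * (1 / real n)"
  have bd: "\<bar>1 / real n * ?Z n - \<alpha> * \<rho>\<bar> \<le> ?r n + \<alpha>\<^sup>2 * W\<^sup>2 / 2" if "n > 0" for n
  proof -
    have "1 / real n * ?Z n - \<alpha> * \<rho> = (?Z n - real n * (\<alpha> * \<rho>)) / real n"
      using that by (simp add: field_simps)
    also have "\<bar>\<dots>\<bar> \<le> (2 * (\<bar>\<alpha>\<bar> * W) + real n * (\<alpha>\<^sup>2 * W\<^sup>2 / 2)) / real n"
      using log_moment_bounds[where \<alpha> = \<alpha> and n = n and x = x] by (simp add: divide_right_mono)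
    also have "\<dots> = ?r n + \<alpha>\<^sup>2 * W\<^sup>2 / 2" using that by (simp add: add_divide_distrib)
    finally show ?thesis .
  qed
  have r: "?r \<longlonglongrightarrow> 0" by (intro tendsto_mult_right_zero lim_1_over_n)
  have ev: "\<forall>\<^sub>F n in sequentially. n > 0" by (rule eventually_gt_at_top)
  have "(\<lambda>n. \<alpha> * \<rho> - ?r n - \<alpha>\<^sup>2 * W\<^sup>2 / 2) \<longlonglongrightarrow> \<alpha> * \<rho> - 0 - \<alpha>\<^sup>2 * W\<^sup>2 / 2"
    by (intro tendsto_intros r)
  then have "liminf (\<lambda>n. ereal (\<alpha> * \<rho> - ?r n - \<alpha>\<^sup>2 * W\<^sup>2 / 2)) = ereal (\<alpha> * \<rho> - \<alpha>\<^sup>2 * W\<^sup>2 / 2)"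
    by (intro lim_imp_Liminf) auto
  moreover have "liminf (\<lambda>n. ereal (\<alpha> * \<rho> - ?r n - \<alpha>\<^sup>2 * W\<^sup>2 / 2)) \<le> I"
    unfolding I_def
  proof (rule Liminf_mono, use ev in eventually_elim)
    case (elim n)
    show ?case using bd[OF elim] unfolding ereal_less_eq by linarith
  qed
  ultimately show "ereal (\<alpha> * \<rho> - \<alpha>\<^sup>2 * W\<^sup>2 / 2) \<le> I" by simp
  have "(\<lambda>n. \<alpha> * \<rho> + ?r n + \<alpha>\<^sup>2 * W\<^sup>2 / 2) \<longlonglongrightarrow> \<alpha> * \<rho> + 0 + \<alpha>\<^sup>2 * W\<^sup>2 / 2"
    by (intro tendsto_intros r)
  then have "liminf (\<lambda>n. ereal (\<alpha> * \<rho> + ?r n + \<alpha>\<^sup>2 * W\<^sup>2 / 2)) = ereal (\<alpha> * \<rho> + \<alpha>\<^sup>2 * W\<^sup>2 / 2)"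
    by (intro lim_imp_Liminf) auto
  moreover have "I \<le> liminf (\<lambda>n. ereal (\<alpha> * \<rho> + ?r n + \<alpha>\<^sup>2 * W\<^sup>2 / 2))"
    unfolding I_def
  proof (rule Liminf_mono, use ev in eventually_elim)
    case (elim n)
    show ?case using bd[OF elim] unfolding ereal_less_eq by linarith
  qed
  ultimately show "I \<le> ereal (\<alpha> * \<rho> + \<alpha>\<^sup>2 * W\<^sup>2 / 2)" by simp
qed

end

section \<open>Dependence of the ergodic average on the kernel\<close>

lemma kernel_op_diff_le_tv:
  assumes Q: "markov_kernel Q" and Q': "markov_kernel Q'"
    and tv: "\<And>B. B \<in> sets borel \<Longrightarrow> \<bar>measure (Q x) B - measure (Q' x) B\<bar> \<le> e"
    and g: "g \<in> borel_measurable borel" "\<And>y. \<bar>g y\<bar> \<le> b"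
  shows "\<bar>kernel_op Q g x - kernel_op Q' g x\<bar> \<le> e * (2 * b)"
proof -
  have gb: "- b \<le> g y \<and> g y \<le> b" for y using g(2)[of y] by (auto simp: abs_le_iff)
  have tv': "measure (Q x) B - measure (Q' x) B \<le> e" "measure (Q' x) B - measure (Q x) B \<le> e"
    if "B \<in> sets borel" for B using tv[OF that] by (auto simp: abs_le_iff)
  note p = prob_space_kernel[OF Q] prob_space_kernel[OF Q'] sets_markov_kernel[OF Q] sets_markov_kernel[OF Q']
  have "kernel_op Q g x - kernel_op Q' g x \<le> e * (b - - b)"
    unfolding kernel_op_def by (rule integral_diff_le[OF p tv'(1) g(1) gb])
  moreover have "kernel_op Q' g x - kernel_op Q g x \<le> e * (b - - b)"
    unfolding kernel_op_def by (rule integral_diff_le[OF p(2,1,4,3) tv'(2) g(1) gb])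
  ultimately show ?thesis by (simp add: abs_le_iff)
qed

locale kernel_convergence =
  fixes Q :: "nat \<Rightarrow> 'e :: topological_space \<Rightarrow> 'e measure" and Q' :: "'e \<Rightarrow> 'e measure"
  assumes kernels: "markov_kernel (Q n)" and kernel': "markov_kernel Q'"
    and tv: "0 < e \<Longrightarrow> \<forall>\<^sub>F n in sequentially. \<forall>B\<in>sets borel. \<bar>measure (Q n x) B - measure (Q' x) B\<bar> \<le> e"
begin

text \<open>The functions may vary with \<open>n\<close>, since the total variation estimate sees
  them only through their common bound \<open>b\<close>.\<close>

lemma kernel_op_diff_tendsto_0:
  assumes g: "\<And>n. g n \<in> borel_measurable borel" "\<And>n y. \<bar>g n y\<bar> \<le> b"
  shows "(\<lambda>n. kernel_op (Q n) (g n) x - kernel_op Q' (g n) x) \<longlonglongrightarrow> 0"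
proof (rule tendstoI)
  fix e :: real assume e: "e > 0"
  have b: "0 \<le> b" using g(2) abs_ge_zero order_trans by blast
  \<comment> \<open>The added 1 keeps the denominator positive when \<open>b = 0\<close> and makes
    \<open>d * (2 * b) < e\<close> strict.\<close>
  define d where "d = e / (2 * b + 1)"
  have d: "d > 0" "d * (2 * b) < e" using e b by (auto simp: d_def field_simps)
  from tv[OF d(1), of x]
  show "\<forall>\<^sub>F n in sequentially. dist (kernel_op (Q n) (g n) x - kernel_op Q' (g n) x) 0 < e"
  proof eventually_elim
    case (elim n)
    have "\<bar>kernel_op (Q n) (g n) x - kernel_op Q' (g n) x\<bar> \<le> d * (2 * b)"
      using elim by (intro kernel_op_diff_le_tv kernels kernel' g) auto
    then show ?case using d(2) by (simp add: dist_real_def)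
  qed
qed

text \<open>Replacing \<open>Q n\<close> by \<open>Q'\<close> costs a null sequence; under the fixed
  measure \<open>Q' x\<close> dominated convergence applies.\<close>

lemma kernel_op_tendsto_0:
  assumes g: "\<And>n. g n \<in> borel_measurable borel" "\<And>n y. \<bar>g n y\<bar> \<le> b"
    and lim: "\<And>y. (\<lambda>n. g n y) \<longlonglongrightarrow> 0"
  shows "(\<lambda>n. kernel_op (Q n) (g n) x) \<longlonglongrightarrow> 0"
proof -
  interpret prob_space "Q' x" by (rule prob_space_kernel[OF kernel'])
  have [measurable]: "g n \<in> borel_measurable (Q' x)" for n
    using g(1)[of n] by (simp add: measurable_cong_sets[OF sets_markov_kernel[OF kernel'] refl])
  have "(\<lambda>n. kernel_op Q' (g n) x) \<longlonglongrightarrow> (\<integral>y. 0 \<partial>Q' x)"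
    unfolding kernel_op_def
    by (rule integral_dominated_convergence[where w = "\<lambda>_. b"]) (use g(2) lim in auto)
  from tendsto_add[OF kernel_op_diff_tendsto_0[where g = g and x = x, OF g] this] show ?thesis by simp
qed

text \<open>The induction closes because \<open>kernel_op_tendsto_0\<close> admits functions
  depending on \<open>n\<close>: each application returns a sequence with the same bound that again
  tends to 0 pointwise.\<close>

lemma kernel_op_pow_tendsto_0:
  assumes g: "\<And>n. g n \<in> borel_measurable borel" "\<And>n y. \<bar>g n y\<bar> \<le> b"
    and lim: "\<And>y. (\<lambda>n. g n y) \<longlonglongrightarrow> 0"
  shows "(\<lambda>n. (kernel_op (Q n) ^^ m) (g n) x) \<longlonglongrightarrow> 0"
proof (induction m arbitrary: x)
  case 0
  then show ?case using lim by simp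
next
  case (Suc m)
  then show ?case
    by (simp, intro kernel_op_tendsto_0[where b = b] kernel_op_pow_measurable kernel_op_pow_abs_le kernels g)
qed

end

text \<open>The last \<open>m\<close> steps are estimated by (ME) with a constant independent of the
  state reached, and averaging a constant over the first \<open>k\<close> steps changes nothing. The
  bound is free of \<open>k\<close>, so it survives the passage to the stationary regime.\<close>

lemma kernel_op_pow_minorized:
  assumes Q: "markov_kernel Q"
    and me: "\<And>x B. B \<in> sets borel \<Longrightarrow> measure (kernel_pow Q m x) B \<le> K * measure (kernel_pow Q m x') B"
    and h: "h \<in> borel_measurable borel" "\<And>y. 0 \<le> h y" "\<And>y. h y \<le> b"
  shows "(kernel_op Q ^^ (k + m)) h x \<le> K * (kernel_op Q ^^ m) h x'"
proof -
  have hb: "\<bar>h y\<bar> \<le> b" for y using h(2,3) by simp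
  have "(kernel_op Q ^^ m) h y \<le> K * (kernel_op Q ^^ m) h x'" for y
    unfolding integral_kernel_pow[OF Q h(1) hb, symmetric]
    by (intro integral_le_mult[of _ _ borel _ _ b] prob_space_kernel sets_markov_kernel
        markov_kernel_pow Q me h)
  moreover have "0 \<le> (kernel_op Q ^^ m) h y" for y
    using kernel_op_pow_bounds[OF Q h(1), of 0 b m y] h by auto
  ultimately have "(kernel_op Q ^^ k) ((kernel_op Q ^^ m) h) x \<le> K * (kernel_op Q ^^ m) h x'"
    using kernel_op_pow_bounds[OF Q kernel_op_pow_measurable[OF Q h(1)], of 0 m "K * (kernel_op Q ^^ m) h x'" k x]
    by auto
  then show ?thesis by (simp add: funpow_add)
qed

text \<open>High powers of \<open>Q\<close> stand in for its stationary law. The Poisson equation of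
  \<open>Q'\<close> gives \<open>f - \<rho>' = ?d + w' - Q w'\<close>; under powers of
  \<open>Q\<close> the part with \<open>w'\<close> becomes a difference of consecutive iterates and
  vanishes in the limit, and \<open>?d\<close> is dominated by \<open>?h\<close>.\<close>

lemma ergodic_limit_perturbation:
  assumes "contracting_kernel Q \<Delta>" and Q': "markov_kernel Q'"
    and me: "\<And>x B. B \<in> sets borel \<Longrightarrow> measure (kernel_pow Q m x) B \<le> K * measure (kernel_pow Q m x') B"
    and f: "f \<in> borel_measurable borel" "\<And>y. \<bar>f y\<bar> \<le> M"
    and f': "f' \<in> borel_measurable borel" "\<And>y. \<bar>f' y\<bar> \<le> M"
    and w': "w' \<in> borel_measurable borel" "\<And>y. \<bar>w' y\<bar> \<le> W"
    and poisson': "\<And>y. w' y - kernel_op Q' w' y = f' y - \<rho>'"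
    and \<rho>: "\<And>y. (\<lambda>k. (kernel_op Q ^^ k) f y) \<longlonglongrightarrow> \<rho>"
  shows "\<bar>\<rho> - \<rho>'\<bar> \<le> K * (kernel_op Q ^^ m)
    (\<lambda>y. \<bar>f y - f' y\<bar> + \<bar>kernel_op Q w' y - kernel_op Q' w' y\<bar>) x'"
proof -
  interpret contracting_kernel Q \<Delta> by fact
  note [measurable] = f(1) f'(1) w'(1) kernel_op_measurable[OF kernel w'(1)] kernel_op_measurable[OF Q' w'(1)]
  have Ww: "\<bar>kernel_op Q w' y\<bar> \<le> W" "\<bar>kernel_op Q' w' y\<bar> \<le> W" for y
    using kernel_op_abs_le[OF kernel w'] kernel_op_abs_le[OF Q' w'] by auto
  let ?h = "\<lambda>y. \<bar>f y - f' y\<bar> + \<bar>kernel_op Q w' y - kernel_op Q' w' y\<bar>"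
  let ?d = "\<lambda>y. f y - f' y + (kernel_op Q w' y - kernel_op Q' w' y)"
  let ?e = "\<lambda>y. w' y + (- \<rho>' + - kernel_op Q w' y)"
  have h: "?h \<in> borel_measurable borel" "0 \<le> ?h y" "?h y \<le> 2 * M + 2 * W" for y
    using f(2)[of y] f'(2)[of y] Ww[of y] by (simp, simp, linarith)
  have hb: "\<bar>?h y\<bar> \<le> 2 * M + 2 * W" for y using h(2,3)[of y] by simp
  have d: "?d \<in> borel_measurable borel" "\<bar>?d y\<bar> \<le> 2 * M + 2 * W" for y
    using f(2)[of y] f'(2)[of y] Ww[of y] by (simp, linarith)
  have nd: "(\<lambda>y. - ?d y) \<in> borel_measurable borel" "\<bar>- ?d y\<bar> \<le> 2 * M + 2 * W" for y
    using borel_measurable_uminus[OF d(1)] d(2)[of y] by (simp_all only: abs_minus_cancel)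
  define K' where "K' = K * (kernel_op Q ^^ m) ?h x'"
  have dK: "\<bar>(kernel_op Q ^^ (k + m)) ?d x'\<bar> \<le> K'" for k
  proof -
    have "(kernel_op Q ^^ (k + m)) ?d x' \<le> (kernel_op Q ^^ (k + m)) ?h x'"
      by (rule kernel_op_pow_mono[OF kernel d h(1) hb]) linarith
    moreover have "(kernel_op Q ^^ (k + m)) (\<lambda>y. - ?d y) x' \<le> (kernel_op Q ^^ (k + m)) ?h x'"
      by (rule kernel_op_pow_mono[OF kernel nd h(1) hb]) linarith
    \<comment> \<open>The iterates of \<open>?d\<close> and of its negative are opposite, so the two
      upper bounds together control the absolute value.\<close>
    moreover have "(kernel_op Q ^^ (k + m)) ?d x' + (kernel_op Q ^^ (k + m)) (\<lambda>y. - ?d y) x' = 0"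
      using fun_cong[OF kernel_op_pow_add[OF kernel d nd], of "k + m" x']
      by (simp only: add.right_inverse kernel_op_pow_const[OF kernel])
    moreover have "(kernel_op Q ^^ (k + m)) ?h x' \<le> K'"
      unfolding K'_def by (rule kernel_op_pow_minorized[OF kernel me h])
    ultimately show ?thesis by linarith
  qed
  obtain c where c: "(\<lambda>k. (kernel_op Q ^^ k) w' y) \<longlonglongrightarrow> c" for y
    using poisson[OF w'] by metis
  have dec: "(kernel_op Q ^^ k) f y - \<rho>' =
      (kernel_op Q ^^ k) ?d y + ((kernel_op Q ^^ k) w' y - (kernel_op Q ^^ Suc k) w' y)" for k y
  proof -
    \<comment> \<open>The identity is arranged with sums only, so that additivity of the iterates
      can be applied to both sides.\<close>
    have "(\<lambda>y. (f y + - \<rho>') + kernel_op Q w' y) = (\<lambda>y. ?d y + w' y)"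
      using poisson' by (auto simp: fun_eq_iff algebra_simps)
    then have "(kernel_op Q ^^ k) (\<lambda>y. (f y + - \<rho>') + kernel_op Q w' y) y = (kernel_op Q ^^ k) (\<lambda>y. ?d y + w' y) y"
      by simp
    moreover have "\<bar>f y + - \<rho>'\<bar> \<le> M + \<bar>\<rho>'\<bar>" for y using f(2)[of y] by linarith
    note kernel_op_pow_add[OF kernel _ this kernel_op_measurable[OF kernel w'(1)] Ww(1), where k = k]
    moreover note kernel_op_pow_add[OF kernel f, where h = "\<lambda>_. - \<rho>'" and b' = "\<bar>\<rho>'\<bar>" and k = k]
    moreover note kernel_op_pow_add[OF kernel d w', where k = k]
    ultimately show ?thesis
      by (simp add: kernel_op_pow_const[OF kernel] funpow_swap1)
  qed
  have "(\<lambda>k. \<bar>(kernel_op Q ^^ (k + m)) f x' - \<rho>'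
      - ((kernel_op Q ^^ (k + m)) w' x' - (kernel_op Q ^^ Suc (k + m)) w' x')\<bar>)
      \<longlonglongrightarrow> \<bar>\<rho> - \<rho>' - (c - c)\<bar>"
    using LIMSEQ_ignore_initial_segment[OF \<rho>[of x'], of m] LIMSEQ_ignore_initial_segment[OF c[of x'], of m]
      LIMSEQ_ignore_initial_segment[OF c[of x'], of "Suc m"]
    by (intro tendsto_intros) (simp_all del: funpow.simps)
  then have "\<bar>\<rho> - \<rho>' - (c - c)\<bar> \<le> K'"
    using dK by (intro LIMSEQ_le_const2) (auto simp only: dec add_diff_cancel_right' intro!: exI)
  then show ?thesis by (simp add: K'_def)
qed

section \<open>Use of (UE) and (ME), and passage to the limit\<close>

lemma UE_D:
  assumes "UE U P" "U \<noteq> {}"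
  obtains \<Delta> where "0 \<le> \<Delta>" "\<Delta> < 1"
    "\<And>x x' a a' B. a \<in> U \<Longrightarrow> a' \<in> U \<Longrightarrow> B \<in> sets borel \<Longrightarrow>
      measure (P a x) B - measure (P a' x') B \<le> \<Delta>"
proof -
  define S where "S = (SUP x. SUP x'. SUP a\<in>U. SUP a'\<in>U. SUP B\<in>sets borel.
    ereal (measure (P a x) B - measure (P a' x') B))"
  have S1: "S < 1" using assms(1) unfolding UE_def S_def .
  have le: "ereal (measure (P a x) B - measure (P a' x') B) \<le> S"
    if "a \<in> U" "a' \<in> U" "B \<in> sets borel" for a a' x x' B
    unfolding S_def
    by (intro SUP_upper2[of x] SUP_upper2[of x'] SUP_upper2[of a] SUP_upper2[of a'] SUP_upper2[of B] that) auto
  \<comment> \<open>The empty event contributes the value 0, so the supremum is at least 0; being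
    also below 1, it is a real number.\<close>
  obtain a where "a \<in> U" using assms(2) by auto
  from le[OF this this, of "{}"] have S0: "0 \<le> S" by (simp add: zero_ereal_def)
  then obtain \<Delta> where S: "S = ereal \<Delta>" using S1 by (cases S) auto
  show ?thesis using that[of \<Delta>] le S0 S1 unfolding S by simp
qed


theorem theorem6:
  fixes U :: "'u :: topological_space set"
    and \<U> :: "('e :: polish_space \<Rightarrow> 'u) set"
    and P :: "'u \<Rightarrow> 'e \<Rightarrow> 'e measure"
    and un :: "nat \<Rightarrow> 'e \<Rightarrow> 'u" and u :: "'e \<Rightarrow> 'u"
    and c :: "'e \<times> 'u \<Rightarrow> real" and \<alpha> :: "nat \<Rightarrow> real"
  assumes "controlled_markov U \<U> P"
    and "UE U P"
    and "ME \<U> P"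
    and "\<And>n. un n \<in> \<U>" and "u \<in> \<U>"
    and "\<And>x. (\<lambda>n. un n x) \<longlonglongrightarrow> u x"
    and "\<And>x. (\<lambda>n. SUP B\<in>sets borel.
           ereal \<bar>measure (P (un n x) x) B - measure (P (u x) x) B\<bar>) \<longlonglongrightarrow> 0"
    and "bounded (c ` (UNIV \<times> U))"
    and "c \<in> borel_measurable (borel \<Otimes>\<^sub>M restrict_space borel U)"
    and "\<And>x. continuous_on U (\<lambda>a. c (x, a))"
    and "\<And>n. \<alpha> n \<noteq> 0" and "\<alpha> \<longlonglongrightarrow> 0"
  shows "\<forall>x. (\<lambda>n. ereal (1 / \<alpha> n) * risk_cost P c (\<alpha> n) x (un n)) \<longlonglongrightarrow> average_cost P c x u"
proof -
  interpret controlled_markov U \<U> P by fact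
  note un = assms(4) and u = assms(5)
  have mem: "v x \<in> U" if "v \<in> \<U>" for v x
    using measurable_space[OF measurable_control[OF that], of x] by (simp add: space_restrict_space)
  then have "U \<noteq> {}" using u by blast
  with assms(2) obtain \<Delta> where \<Delta>: "0 \<le> \<Delta>" "\<Delta> < 1"
    "\<And>x x' a a' B. a \<in> U \<Longrightarrow> a' \<in> U \<Longrightarrow> B \<in> sets borel \<Longrightarrow>
      measure (P a x) B - measure (P a' x') B \<le> \<Delta>"
    by (rule UE_D) blast
  let ?Q = "controlled_kernel P"
  have Q_eq: "?Q v = (\<lambda>x. P (v x) x)" for v by (simp add: controlled_kernel_def fun_eq_iff)
  have contr: "contracting_kernel (?Q v) \<Delta>" if "v \<in> \<U>" for v
    using kernel_control[OF that] \<Delta> mem[OF that] by unfold_locales (auto simp: Q_eq)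
  obtain M where M: "\<bar>c (x, a)\<bar> \<le> M" if "a \<in> U" for x a
    using assms(8) unfolding bounded_iff by auto
  define f where "f v x = c (x, v x)" for v x
  have fm: "f v \<in> borel_measurable borel" if "v \<in> \<U>" for v
    unfolding f_def using measurable_compose[OF measurable_Pair[OF measurable_ident measurable_control[OF that]] assms(9)]
    by simp
  have fM: "\<bar>f v x\<bar> \<le> M" if "v \<in> \<U>" for v x
    unfolding f_def by (intro M mem that)
  define W where "W = 2 * M / (1 - \<Delta>)"
  \<comment> \<open>A constant and a Poisson solution are chosen for every control, all with the
    same bound \<open>W\<close>; this uniformity allows \<open>\<alpha> n\<close> and
    \<open>un n\<close> to vary together.\<close>
  have "\<exists>\<rho> w. (\<forall>x. (\<lambda>k. (kernel_op (?Q v) ^^ k) (f v) x) \<longlonglongrightarrow> \<rho>) \<and> w \<in> borel_measurable borel \<and>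
      (\<forall>x. \<bar>w x\<bar> \<le> W) \<and> (\<forall>x. w x - kernel_op (?Q v) w x = f v x - \<rho>)" if "v \<in> \<U>" for v
    using contracting_kernel.poisson[OF contr[OF that] fm[OF that] fM[OF that]] unfolding W_def by metis
  then obtain \<rho> w where lim: "\<And>v x. v \<in> \<U> \<Longrightarrow> (\<lambda>k. (kernel_op (?Q v) ^^ k) (f v) x) \<longlonglongrightarrow> \<rho> v"
    and w: "\<And>v. v \<in> \<U> \<Longrightarrow> w v \<in> borel_measurable borel" "\<And>v x. v \<in> \<U> \<Longrightarrow> \<bar>w v x\<bar> \<le> W"
    and poisson: "\<And>v x. v \<in> \<U> \<Longrightarrow> w v x - kernel_op (?Q v) (w v) x = f v x - \<rho> v"
    by metis
  have kern: "markov_kernel (?Q v)" if "v \<in> \<U>" for v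
    unfolding Q_eq by (rule kernel_control[OF that])
  have sol: "poisson_solution (?Q v) (f v) (w v) (\<rho> v) M W" if "v \<in> \<U>" for v
    using kern fm fM w poisson that by unfold_locales auto
  obtain m K where me: "\<And>x x' v B. v \<in> \<U> \<Longrightarrow> B \<in> sets borel \<Longrightarrow>
      measure (kernel_pow (?Q v) m x) B \<le> K * measure (kernel_pow (?Q v) m x') B"
    using assms(3) unfolding ME_def by blast
  interpret kernel_convergence "\<lambda>n. ?Q (un n)" "?Q u"
  proof
    show "markov_kernel (?Q (un n))" for n by (rule kern[OF un])
    show "markov_kernel (?Q u)" by (rule kern[OF u])
    fix e :: real and x :: 'e assume "0 < e"
    then have "\<forall>\<^sub>F n in sequentially. (SUP B\<in>sets borel.
        ereal \<bar>measure (P (un n x) x) B - measure (P (u x) x) B\<bar>) < ereal e"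
      by (intro order_tendstoD(2)[OF assms(7)]) auto
    then show "\<forall>\<^sub>F n in sequentially. \<forall>B\<in>sets borel.
        \<bar>measure (?Q (un n) x) B - measure (?Q u x) B\<bar> \<le> e"
    proof (rule eventually_mono, intro ballI)
      fix n and B :: "'e set"
      assume s: "(SUP B\<in>sets borel. ereal \<bar>measure (P (un n x) x) B - measure (P (u x) x) B\<bar>) < ereal e"
        and B: "B \<in> sets borel"
      have "ereal \<bar>measure (P (un n x) x) B - measure (P (u x) x) B\<bar> < ereal e"
        by (rule le_less_trans[OF SUP_upper[OF B] s])
      then show "\<bar>measure (?Q (un n) x) B - measure (?Q u x) B\<bar> \<le> e" by (simp add: Q_eq)
    qed
  qed
  \<comment> \<open>The integrand of \<open>ergodic_limit_perturbation\<close> with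
    \<open>un n\<close> as the perturbed control. It uses the solution \<open>w u\<close> of the
    limit control, a function that does not move with \<open>n\<close>.\<close>
  define h where "h n y = \<bar>f (un n) y - f u y\<bar> + \<bar>kernel_op (?Q (un n)) (w u) y - kernel_op (?Q u) (w u) y\<bar>" for n y
  have Qw: "\<bar>kernel_op (?Q v) (w u) y\<bar> \<le> W" if "v \<in> \<U>" for v y
    by (rule kernel_op_abs_le[OF kern[OF that] w[OF u]])
  have h_meas: "h n \<in> borel_measurable borel" for n
    unfolding h_def using fm[OF un, of n] fm[OF u] kernel_op_measurable[OF kern[OF un] w(1)[OF u], of n]
      kernel_op_measurable[OF kern[OF u] w(1)[OF u]] by measurable
  have h_bound: "\<bar>h n y\<bar> \<le> 2 * M + 2 * W" for n y
    using fM[OF un, of n y] fM[OF u, of y] Qw[OF un, of n y] Qw[OF u, of y] unfolding h_def by linarith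
  have h_lim: "(\<lambda>n. h n y) \<longlonglongrightarrow> 0" for y
  proof -
    have "(\<lambda>n. f (un n) y) \<longlonglongrightarrow> f u y"
      unfolding f_def using mem[OF u] mem[OF un]
      by (intro continuous_on_tendsto_compose[OF assms(10) assms(6)]) auto
    then have "(\<lambda>n. \<bar>f (un n) y - f u y\<bar>) \<longlonglongrightarrow> 0"
      by (intro tendsto_rabs_zero) (simp add: LIM_zero_iff)
    moreover have "(\<lambda>n. \<bar>kernel_op (?Q (un n)) (w u) y - kernel_op (?Q u) (w u) y\<bar>) \<longlonglongrightarrow> 0"
      by (intro tendsto_rabs_zero kernel_op_diff_tendsto_0[where g = "\<lambda>_. w u" and b = W] w u)
    ultimately show ?thesis unfolding h_def using tendsto_add by fastforce
  qed
  have "(\<lambda>n. \<rho> (un n) - \<rho> u) \<longlonglongrightarrow> 0"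
  proof (rule Lim_null_comparison)
    \<comment> \<open>Any fixed reference state can serve in (ME); here it is
      \<open>undefined\<close>.\<close>
    show "\<forall>\<^sub>F n in sequentially.
        norm (\<rho> (un n) - \<rho> u) \<le> K * (kernel_op (?Q (un n)) ^^ m) (h n) undefined"
    proof (rule always_eventually, rule allI)
      fix n
      show "norm (\<rho> (un n) - \<rho> u) \<le> K * (kernel_op (?Q (un n)) ^^ m) (h n) undefined"
        unfolding h_def real_norm_def
        by (rule ergodic_limit_perturbation[OF contr[OF un] kern[OF u] me[OF un]
            fm[OF un] fM[OF un] fm[OF u] fM[OF u] w[OF u] poisson[OF u] lim[OF un]])
    qed
    show "(\<lambda>n. K * (kernel_op (?Q (un n)) ^^ m) (h n) undefined) \<longlonglongrightarrow> 0"
      by (intro tendsto_mult_right_zero kernel_op_pow_tendsto_0[where g = h, OF h_meas h_bound h_lim])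
  qed
  then have \<rho>_lim: "(\<lambda>n. \<rho> (un n)) \<longlonglongrightarrow> \<rho> u" by (simp add: LIM_zero_iff)
  show ?thesis
  proof
    fix x
    have "(\<lambda>n. ereal (1 / real n * (\<integral>\<omega>. (\<Sum>i<n. f u (\<omega> i)) \<partial>path_measure (?Q u) x))) \<longlonglongrightarrow> ereal (\<rho> u)"
      using poisson_solution.average_limit[OF sol[OF u], of x] by simp
    then have J: "average_cost P c x u = ereal (\<rho> u)"
      unfolding average_cost_def f_def by (intro lim_imp_Liminf) auto
    \<comment> \<open>The two-sided bounds make the extended real risk cost finite, so the remaining
      estimates take place in the reals.\<close>
    define r where "r n = real_of_ereal (risk_cost P c (\<alpha> n) x (un n))" for n
    have r: "risk_cost P c (\<alpha> n) x (un n) = ereal (r n)"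
        "\<bar>r n - \<alpha> n * \<rho> (un n)\<bar> \<le> (\<alpha> n)\<^sup>2 * W\<^sup>2 / 2" for n
    proof -
      note b = poisson_solution.liminf_log_moment_bounds[OF sol[OF un[of n]], where \<alpha> = "\<alpha> n" and x = x,
          unfolded f_def, folded risk_cost_def]
      show "risk_cost P c (\<alpha> n) x (un n) = ereal (r n)"
        using b unfolding r_def by (cases "risk_cost P c (\<alpha> n) x (un n)") auto
      with b have "\<alpha> n * \<rho> (un n) - (\<alpha> n)\<^sup>2 * W\<^sup>2 / 2 \<le> r n"
        "r n \<le> \<alpha> n * \<rho> (un n) + (\<alpha> n)\<^sup>2 * W\<^sup>2 / 2" by simp_all
      then show "\<bar>r n - \<alpha> n * \<rho> (un n)\<bar> \<le> (\<alpha> n)\<^sup>2 * W\<^sup>2 / 2" by linarith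
    qed
    have "(\<lambda>n. 1 / \<alpha> n * r n - \<rho> (un n)) \<longlonglongrightarrow> 0"
    proof (rule Lim_null_comparison)
      \<comment> \<open>Division by \<open>\<alpha> n\<close> leaves one power of it in the
        quadratic error; absolute values handle both signs.\<close>
      show "\<forall>\<^sub>F n in sequentially. norm (1 / \<alpha> n * r n - \<rho> (un n)) \<le> \<bar>\<alpha> n\<bar> * (W\<^sup>2 / 2)"
      proof (rule always_eventually, rule allI)
        fix n
        have "1 / \<alpha> n * r n - \<rho> (un n) = (r n - \<alpha> n * \<rho> (un n)) / \<alpha> n"
          using assms(11)[of n] by (simp add: field_simps)
        also have "\<bar>\<dots>\<bar> \<le> (\<alpha> n)\<^sup>2 * W\<^sup>2 / 2 / \<bar>\<alpha> n\<bar>"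
          unfolding abs_divide by (rule divide_right_mono[OF r(2)]) simp
        also have "\<dots> = \<bar>\<alpha> n\<bar> * (W\<^sup>2 / 2)"
          using assms(11)[of n] unfolding power2_abs[of "\<alpha> n", symmetric]
          by (simp add: power2_eq_square del: power2_abs abs_mult_self_eq)
        finally show "norm (1 / \<alpha> n * r n - \<rho> (un n)) \<le> \<bar>\<alpha> n\<bar> * (W\<^sup>2 / 2)" by simp
      qed
      show "(\<lambda>n. \<bar>\<alpha> n\<bar> * (W\<^sup>2 / 2)) \<longlonglongrightarrow> 0"
        by (intro tendsto_mult_left_zero tendsto_rabs_zero assms(12))
    qed
    from tendsto_add[OF this \<rho>_lim] have "(\<lambda>n. 1 / \<alpha> n * r n) \<longlonglongrightarrow> \<rho> u" by simp
    then show "(\<lambda>n. ereal (1 / \<alpha> n) * risk_cost P c (\<alpha> n) x (un n)) \<longlonglongrightarrow> average_cost P c x u"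
      unfolding J r(1) by simp
  qed
qed

end
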